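(* Let $D_{(e)}$ be a divisor consisting of a chain $D_0,\dots,D_n$ and feathers $\mathfrak F_{ij}$ (with bridge curves $B_{ij}$) attached to $D_i$, arising as the full fibre of a blowup of $U\times\mathbb P^1$ over $\{0\}\times\mathbb P^1$ as described in the context. Suppose that $D_{(e)}$ is distinguished. Then $D_{(e)}$ is rigid provided that all its bridges $B_{ij}$ are $(-1)$-curves and one of the following conditions is satisfied. (i) $D_{(e)}^{>n}\neq\emptyset$. (ii) If for some $i$, $0\le i<n$, the feather collection $\{\mathfrak F_{ij}\}_j$ is non-empty, then the divisor $D_{(e)}^{\ge i+1}$ is not contractible.
   Context: **Setting.** Let $U$ be a neighbourhood of $0\in\mathbb A^1_{\mathbb C}$, $F=\{0\}\times\mathbb P^1\subset W_0=U\times\mathbb P^1$, and $\sigma:W=W_m\to W_{m-1}\to\dots\to W_0$ a sequence of blowups with centers at points of $F$ and infinitely near points. Let $D_{(e)}=\sigma^{-1}(F)$ (reduced), and assume that it has the following dual graph: a linear chain of curves $D_0,D_1,\dots,D_n$, where $D_0=\hat F$ is the proper transform of $F$, together with pairwise disjoint feathers $\mathfrak F_{ij}$, $0\le i\le n$, $1\le j\le r_i$ ($r_i\ge 0$). A feather $\mathfrak F_{ij}$ is a linear chain of smooth rational curves $B_{ij}-R_{ij1}-\dots-R_{ijs_{ij}}$ ($s_{ij}\ge0$), where $B_{ij}$ (the bridge curve) has self-intersection $\le-1$ and meets $D_i$ in one point (distinct points for distinct $j$), $\mathfrak F_{ij}$ is otherwise disjoint from the chain, and all $R_{ijk}^2\le-2$.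 The $D_i$ may be $(-1)$-curves. Put $R_{ij}=\sum_kR_{ijk}$. **Notation.** $A\ominus B$ means that the components of $B$ are removed from $A$. $D_{(e)}^{>i}$ is the union of all connected components of $D_{(e)}\ominus D_i$ not containing $D_0$; $D_{(e)}^{\ge i}$ is the connected component of $D_{(e)}\ominus D_{i-1}$ containing $D_i$. A divisor is contractible if it can be contracted to smooth points by successively blowing down $(-1)$-curves. $D_{(e)}$ is distinguished if there is no index $i$ with $1\le i\le n$ such that $D_{(e)}^{>i}$ is non-empty and contractible. **Rigidity.** Let $G$ be the group of 1-cycles supported on $D_{(e)}$. For a second divisor $D'_{(e)}$ of this kind (curves $D'_i,B'_{ij},R'_{ijk}$, cycle group $G'$) with the same number $m$ of blowups and the same $n$, a formal specialization map is an isomorphism $\delta:G\to G'$ such that (i) $\delta$ respects the intersection forms; (ii) $\delta$ transforms effective cycles into effective cycles; (iii) $\delta(D_i)=D_i'$ for all $i$; (iv) $\delta(R_{ijk})=R'_{i'j'k}$ for some $i',j'$. Its inverse is called a formal generalization map. $D_{(e)}$ is stable under specialization if for every formal specialization map $\delta:G\to G'$ we have $\delta(B_{ij})=B'_{ij}$ with a suitable numbering of $B'_{i1},\dots,B'_{ir_i}$; it is stable under generalization if for every formal generalization map $\gamma:G\to G'$ (i.e. $\gamma^{-1}$ is a formal specialization map) we have $\gamma(B_{ij})=B'_{ij}$ with a suitable numbering of $B'_{i1},\dots,B'_{ir_i}$. It is rigid if it is stable under both.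
   Formalization: Condition (iv) is strengthened: every R'_{i'j'k} must also be the image of some R_{ijk}. Otherwise the claim fails: n=0, D_0²=−2 with two (−1)-feathers B_1, B_2 maps to D_0'−B'−R' (R'²=−2) by B_1↦B', B_2↦B'+R'. *)

theory Defs
  imports "HOL-Algebra.Free_Abelian_Groups"
begin

(* A configuration of curves on a smooth surface is given by its set of components together
   with the matrix q of intersection numbers; q A A is the self-intersection of A.

   full_fibre F m V q: V and q are the components and the intersection matrix of the reduced
   fibre over 0 of a surface that arises from U x P^1 by m successive blowups with centres on
   F = {0} x P^1 and infinitely near.  All components keep their label when they are replaced
   by their proper transforms.  The fibre is at all stages a divisor with simple normal
   crossings whose dual graph is a tree, so a point of it lies on exactly one component
   (and every component has such points) or it is the unique intersection point of two
   components A, C with A.C = 1.  P is the set of the components through the centre, E the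
   exceptional curve, and the new intersection numbers are
   A'.C' = A.C - mult(A) mult(C),  A'.E = mult(A),  E.E = -1. *)

inductive full_fibre ::
  "'a \<Rightarrow> nat \<Rightarrow> 'a set \<Rightarrow> ('a \<Rightarrow> 'a \<Rightarrow> int) \<Rightarrow> bool" for F :: 'a
where
  product: "q F F = 0 \<Longrightarrow> full_fibre F 0 {F} q"
| blowup:
    "\<lbrakk>full_fibre F m V q;
      (\<exists>A\<in>V. P = {A}) \<or> (\<exists>A\<in>V. \<exists>C\<in>V. A \<noteq> C \<and> q A C = 1 \<and> P = {A, C});
      E \<notin> V;
      q' E E = -1;
      \<forall>A\<in>V. q' A E = of_bool (A \<in> P) \<and> q' E A = of_bool (A \<in> P);
      \<forall>A\<in>V. \<forall>C\<in>V. q' A C = q A C - of_bool (A \<in> P) * of_bool (C \<in> P)\<rbrakk>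
     \<Longrightarrow> full_fibre F (Suc m) (insert E V) q'"

(* A configuration of smooth rational curves is contracted by successively blowing down
   (-1)-curves E.  Blowing down changes A.C into A.C + (A.E)(C.E).  The image of a curve C
   has multiplicity C.E in the image point, hence it is again smooth iff C.E <= 1.
   A singular curve remains singular under further blowdowns and could never be contracted
   itself, so this has to be required for all remaining curves C.  Nothing else is required:
   normal crossings may get lost. *)

inductive contractible :: "'a set \<Rightarrow> ('a \<Rightarrow> 'a \<Rightarrow> int) \<Rightarrow> bool"
where
  empty: "contractible {} q"
| blow_down:
    "\<lbrakk>E \<in> S; q E E = -1; \<forall>C\<in>S - {E}. q C E \<le> 1;
      contractible (S - {E}) (\<lambda>A C. q A C + q A E * q C E)\<rbrakk>
     \<Longrightarrow> contractible S q"

(* Ch i is the chain curve D_i, Br i j the bridge B_ij, Re i j k the curve R_ijk;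
   i starts at 0, while j and k start at 1. *)

datatype curve = Ch nat | Br nat nat | Re nat nat nat

(* feathers D i is the number r_i and tail D i j the number s_ij; selfint gives the
   self-intersection numbers. *)

record fibre_div =
  blowups :: nat
  len :: nat
  feathers :: "nat \<Rightarrow> nat"
  tail :: "nat \<Rightarrow> nat \<Rightarrow> nat"
  selfint :: "curve \<Rightarrow> int"

definition bridges :: "fibre_div \<Rightarrow> curve set" where
  "bridges D = {Br i j | i j. i \<le> len D \<and> j \<in> {1..feathers D i}}"

definition tails :: "fibre_div \<Rightarrow> curve set" where
  "tails D = {Re i j k | i j k. i \<le> len D \<and> j \<in> {1..feathers D i} \<and> k \<in> {1..tail D i j}}"

definition curves :: "fibre_div \<Rightarrow> curve set" where
  "curves D = Ch ` {..len D} \<union> bridges D \<union> tails D"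

inductive joined :: "curve \<Rightarrow> curve \<Rightarrow> bool" where
  "joined (Ch i) (Ch (Suc i))"
| "joined (Ch i) (Br i j)"
| "joined (Br i j) (Re i j 1)"
| "joined (Re i j k) (Re i j (Suc k))"

definition meets :: "curve \<Rightarrow> curve \<Rightarrow> bool" where
  "meets A C \<longleftrightarrow> joined A C \<or> joined C A"

definition int_matrix :: "fibre_div \<Rightarrow> curve \<Rightarrow> curve \<Rightarrow> int" where
  "int_matrix D A C = (if A = C then selfint D A else of_bool (meets A C))"

definition feathered_fibre :: "fibre_div \<Rightarrow> bool" where
  "feathered_fibre D \<longleftrightarrow>
     full_fibre (Ch 0) (blowups D) (curves D) (int_matrix D) \<and>
     (\<forall>A\<in>bridges D. selfint D A \<le> -1) \<and>
     (\<forall>A\<in>tails D. selfint D A \<le> -2)"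

(* A reduced divisor is identified with the set of its components. *)

definition component_of :: "curve set \<Rightarrow> curve \<Rightarrow> curve set" where
  "component_of S A = {C \<in> S. (A, C) \<in> {(X, Y). X \<in> S \<and> Y \<in> S \<and> meets X Y}\<^sup>*}"

definition div_gt :: "fibre_div \<Rightarrow> nat \<Rightarrow> curve set" where
  "div_gt D i =
     \<Union> {K. (\<exists>A \<in> curves D - {Ch i}. K = component_of (curves D - {Ch i}) A) \<and> Ch 0 \<notin> K}"

(* only meaningful for 1 <= i <= len D *)
definition div_ge :: "fibre_div \<Rightarrow> nat \<Rightarrow> curve set" where
  "div_ge D i = component_of (curves D - {Ch (i - 1)}) (Ch i)"

definition distinguished :: "fibre_div \<Rightarrow> bool" where
  "distinguished D \<longleftrightarrow>
     \<not> (\<exists>i. 1 \<le> i \<and> i \<le> len D \<and> div_gt D i \<noteq> {} \<and> contractible (div_gt D i) (int_matrix D))"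

definition cycles :: "fibre_div \<Rightarrow> (curve \<Rightarrow>\<^sub>0 int) monoid" where
  "cycles D = free_Abelian_group (curves D)"

definition int_number :: "fibre_div \<Rightarrow> (curve \<Rightarrow>\<^sub>0 int) \<Rightarrow> (curve \<Rightarrow>\<^sub>0 int) \<Rightarrow> int" where
  "int_number D c d =
     (\<Sum>A\<in>Poly_Mapping.keys c. \<Sum>C\<in>Poly_Mapping.keys d.
        Poly_Mapping.lookup c A * Poly_Mapping.lookup d C * int_matrix D A C)"

definition effective :: "(curve \<Rightarrow>\<^sub>0 int) \<Rightarrow> bool" where
  "effective c \<longleftrightarrow> (\<forall>A. 0 \<le> Poly_Mapping.lookup c A)"

(* delta identifies the curves R_ijk of D with the curves R'_ijk of D': R_ijk goes to some
   R'_{i'j'k}, and every curve R'_{i'j'k} is obtained in this way (so D and D' also have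
   equally many feathers).  Without the last condition the rigidity theorem fails: let n = 0,
   D_0^2 = -2, and let D have two feathers at D_0, each a single (-1)-curve B_1, B_2, and D'
   one feather B' - R' with B'^2 = -1, R'^2 = -2.  Then D_0, B_1, B_2 |-> D_0, B', B' + R'
   preserves intersection numbers and effectivity. *)

definition formal_specialization ::
  "fibre_div \<Rightarrow> fibre_div \<Rightarrow> ((curve \<Rightarrow>\<^sub>0 int) \<Rightarrow> (curve \<Rightarrow>\<^sub>0 int)) \<Rightarrow> bool" where
  "formal_specialization D D' \<delta> \<longleftrightarrow>
     blowups D' = blowups D \<and> len D' = len D \<and>
     \<delta> \<in> iso (cycles D) (cycles D') \<and>
     (\<forall>c\<in>carrier (cycles D). \<forall>d\<in>carrier (cycles D).
        int_number D' (\<delta> c) (\<delta> d) = int_number D c d) \<and>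
     (\<forall>c\<in>carrier (cycles D). effective c \<longrightarrow> effective (\<delta> c)) \<and>
     (\<forall>i\<le>len D. \<delta> (frag_of (Ch i)) = frag_of (Ch i)) \<and>
     (\<forall>i j k. Re i j k \<in> tails D \<longrightarrow>
        (\<exists>i' j'. Re i' j' k \<in> tails D' \<and> \<delta> (frag_of (Re i j k)) = frag_of (Re i' j' k))) \<and>
     (\<forall>i' j' k. Re i' j' k \<in> tails D' \<longrightarrow>
        (\<exists>i j. Re i j k \<in> tails D \<and> \<delta> (frag_of (Re i j k)) = frag_of (Re i' j' k)))"

definition formal_generalization ::
  "fibre_div \<Rightarrow> fibre_div \<Rightarrow> ((curve \<Rightarrow>\<^sub>0 int) \<Rightarrow> (curve \<Rightarrow>\<^sub>0 int)) \<Rightarrow> bool" where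
  "formal_generalization D D' \<gamma> \<longleftrightarrow>
     \<gamma> \<in> iso (cycles D) (cycles D') \<and>
     formal_specialization D' D (inv_into (carrier (cycles D)) \<gamma>)"

definition maps_bridges ::
  "fibre_div \<Rightarrow> fibre_div \<Rightarrow> ((curve \<Rightarrow>\<^sub>0 int) \<Rightarrow> (curve \<Rightarrow>\<^sub>0 int)) \<Rightarrow> bool" where
  "maps_bridges D D' \<phi> \<longleftrightarrow>
     (\<forall>i\<le>len D. \<exists>\<pi>. bij_betw \<pi> {1..feathers D i} {1..feathers D' i} \<and>
        (\<forall>j\<in>{1..feathers D i}. \<phi> (frag_of (Br i j)) = frag_of (Br i (\<pi> j))))"

definition stable_under_specialization :: "fibre_div \<Rightarrow> bool" where
  "stable_under_specialization D \<longleftrightarrow>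
     (\<forall>D' \<delta>. feathered_fibre D' \<longrightarrow> formal_specialization D D' \<delta> \<longrightarrow> maps_bridges D D' \<delta>)"

definition stable_under_generalization :: "fibre_div \<Rightarrow> bool" where
  "stable_under_generalization D \<longleftrightarrow>
     (\<forall>D' \<gamma>. feathered_fibre D' \<longrightarrow> formal_generalization D D' \<gamma> \<longrightarrow> maps_bridges D D' \<gamma>)"

definition rigid :: "fibre_div \<Rightarrow> bool" where
  "rigid D \<longleftrightarrow> stable_under_specialization D \<and> stable_under_generalization D"

end

(* A history of blowups attaches to every curve c other than Ch 0 the set P c of curves through its
   centre. In the coordinates n_c(x) = x_c - (sum of x over P c) the intersection form becomes
   -sum n_c(x) n_c(y) over c other than Ch 0, so the classes of self-intersection -1 with zero
   coefficient at Ch 0 are, up to sign, the total transforms e_c. A specialization fixes the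
   coefficient at Ch 0, because it carries the full fibre to the full fibre. Hence it maps a
   (-1)-bridge at Ch i to some e_c, and the intersection numbers force c to be a bridge. If no
   curve is infinitely near to c, this is the assertion. Otherwise c is a bridge at some Ch p with
   i < p, and all of Ch (i+1), ..., Ch n are infinitely near to c. Since a new curve of the tree
   has at most two neighbours, everything else beyond Ch p is contracted before Ch p. For maximal p
   this part is a copy of D^{>p}, which is therefore empty, so p = n. Then the curves infinitely
   near to c form a copy of D^{>=i+1}, which is contractible. Both contradict the hypotheses.
   The inverse of a generalization onto D also sends bridges to some e_c, so the same argument
   applies to it. *)

theory Submission
  imports Defs
begin

section \<open>Histories of blowups\<close>

text \<open>Two fibres are involved. The history, the classes e_c and the infinitely near curves
  belong to the arbitrary D', whereas distinguishedness and the non-contractibility condition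
  concern D. So each contractible piece found in D' has to be carried back to D. The obstacle is
  that the induced bijection \<open>\<Phi>\<close> of curves preserves intersection numbers only
  away from bridges whose image e_c is reducible (the jumping ones). Since jumps go strictly up the
  chain and no two of them can cover the same chain curve at which one lands, a suitable region of D
  contains no jumping bridge, and there \<open>\<Phi>\<close> is an isometry. The curve c is a
  bridge because all chain and tail curves of D' are images of curves other than the given bridge,
  so they meet its image non-negatively, while e_c has number -1 with c. The bound -2 for the tail
  curves enters repeatedly in one form: a contractible set of tail curves is empty. This shows that
  the curves infinitely near to c leave its feather and that they avoid its tail. The full fibre is
  preserved because it spans the radical of the intersection form.\<close>

inductive blowup_history ::
  "'a \<Rightarrow> ('a \<Rightarrow> 'a set) \<Rightarrow> 'a list \<Rightarrow> ('a \<Rightarrow> 'a \<Rightarrow> int) \<Rightarrow> bool" for F P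
where
  start: "q F F = 0 \<Longrightarrow> P F = {} \<Longrightarrow> blowup_history F P [F] q"
| step:
    "\<lbrakk>blowup_history F P es q;
      (\<exists>A\<in>set es. P E = {A}) \<or>
      (\<exists>A\<in>set es. \<exists>C\<in>set es. A \<noteq> C \<and> q A C = 1 \<and> P E = {A, C});
      E \<notin> set es;
      q' E E = -1;
      \<And>A. A \<in> set es \<Longrightarrow> q' A E = of_bool (A \<in> P E);
      \<And>A. A \<in> set es \<Longrightarrow> q' E A = of_bool (A \<in> P E);
      \<And>A C. A \<in> set es \<Longrightarrow> C \<in> set es \<Longrightarrow>
        q' A C = q A C - of_bool (A \<in> P E) * of_bool (C \<in> P E)\<rbrakk>
     \<Longrightarrow> blowup_history F P (E # es) q'"

lemma blowup_history_cong:
  assumes "blowup_history F P es q" and "\<And>A. A \<in> set es \<Longrightarrow> P A = P' A"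
  shows "blowup_history F P' es q"
  using assms
proof (induction rule: blowup_history.induct)
  case (start q)
  then show ?case by (auto intro: blowup_history.start)
next
  case (step es q E q')
  have "blowup_history F P' es q" using step by auto
  moreover have "P E = P' E" using step.prems by simp
  ultimately show ?case using step.hyps(2-7) by (intro blowup_history.step[of F P' es q]) auto
qed

text \<open>\<open>full_fibre\<close> forgets the order of the blowups and their centres. A history
  keeps both: \<open>es\<close> is newest first, and one function \<open>P\<close> serves all
  stages. Setting its value at the new curve does not affect earlier stages, by
  \<open>blowup_history_cong\<close>.\<close>

lemma full_fibre_history:
  assumes "full_fibre F m V q"
  shows "\<exists>P es. blowup_history F P es q \<and> set es = V \<and> length es = Suc m"
  using assms
proof (induction rule: full_fibre.induct)
  case (product q)
  then have "blowup_history F (\<lambda>_. {}) [F] q" by (auto intro: blowup_history.start)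
  then show ?case by force
next
  case (blowup m V q P E q')
  then obtain P0 es where h: "blowup_history F P0 es q" "set es = V" "length es = Suc m" by blast
  have "blowup_history F (P0(E := P)) es q"
    by (rule blowup_history_cong[OF h(1)]) (use h blowup in auto)
  then have "blowup_history F (P0(E := P)) (E # es) q'"
    using blowup.hyps h by (intro blowup_history.step) auto
  then show ?case using h by force
qed

lemma history_tail:
  "blowup_history F P (E # es) q \<Longrightarrow> es \<noteq> [] \<Longrightarrow> \<exists>q0. blowup_history F P es q0"
  by (erule blowup_history.cases) auto

lemma history_distinct: "blowup_history F P es q \<Longrightarrow> distinct es"
  by (induction rule: blowup_history.induct) auto

lemma history_base_mem: "blowup_history F P es q \<Longrightarrow> F \<in> set es"
  by (induction rule: blowup_history.induct) auto

lemma history_base_centre: "blowup_history F P es q \<Longrightarrow> P F = {}"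
  by (induction rule: blowup_history.induct) auto

lemma history_sym:
  "blowup_history F P es q \<Longrightarrow> A \<in> set es \<Longrightarrow> C \<in> set es \<Longrightarrow> q A C = q C A"
  by (induction arbitrary: A C rule: blowup_history.induct) auto

lemma history_centre_subset: "blowup_history F P es q \<Longrightarrow> A \<in> set es \<Longrightarrow> P A \<subseteq> set es"
  by (induction rule: blowup_history.induct) auto

lemma history_suffix:
  "blowup_history F P (xs @ z # ys) q \<Longrightarrow>
     (\<exists>q0. blowup_history F P (z # ys) q0) \<and> P z \<subseteq> set ys"
proof (induction xs arbitrary: q)
  case Nil
  then have h: "blowup_history F P (z # ys) q" by simp
  then have "P z \<subseteq> set ys" by (cases rule: blowup_history.cases) auto
  then show ?case using h by blast
next
  case (Cons E xs)
  then have "blowup_history F P (E # (xs @ z # ys)) q" by simp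
  then obtain q1 where "blowup_history F P (xs @ z # ys) q1"
    by (cases rule: blowup_history.cases) auto
  then show ?case by (rule Cons.IH)
qed

lemma history_centre_nonempty:
  "blowup_history F P es q \<Longrightarrow> A \<in> set es \<Longrightarrow> A \<noteq> F \<Longrightarrow> P A \<noteq> {}"
  by (induction rule: blowup_history.induct) auto

lemma history_finite_centre: "blowup_history F P es q \<Longrightarrow> A \<in> set es \<Longrightarrow> finite (P A)"
  by (rule finite_subset[OF history_centre_subset]) auto

text \<open>A blowup destroys an edge only between two curves of \<open>P E\<close>, and
  \<open>E\<close> meets both. So if no edge crosses \<open>X\<close> now, \<open>P E\<close> lies
  on one side of \<open>X\<close>, and no edge crossed it before.\<close>

lemma history_connected:
  assumes "blowup_history F P es q" and "A \<in> X \<inter> set es" and "C \<in> set es - X"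
  shows "\<exists>A\<in>X \<inter> set es. \<exists>C\<in>set es - X. q A C \<noteq> 0"
  using assms
proof (induction arbitrary: A C rule: blowup_history.induct)
  case (start q)
  then show ?case by auto
next
  case (step es q E q')
  show ?case
  proof (rule ccontr)
    assume "\<not> ?thesis"
    then have no: "q' A C = 0" if "A \<in> X" "A \<in> insert E (set es)" "C \<in> insert E (set es)" "C \<notin> X" for A C
      using that by auto
    have ne: "P E \<noteq> {}" "P E \<subseteq> set es" using step.hyps(2) by auto
    have side: "P E \<subseteq> X \<and> E \<in> X \<or> P E \<inter> X = {} \<and> E \<notin> X"
    proof (cases "E \<in> X")
      case True
      then show ?thesis using no[of E] step.hyps(6) ne(2) by fastforce
    next
      case False
      then show ?thesis using no[of _ E] step.hyps(5) ne(2) by fastforce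
    qed
    \<comment> \<open>\<open>E\<close> lies on the same side as the non-empty set
      \<open>P E\<close>, so both sides are still inhabited when \<open>E\<close> is
      removed.\<close>
    then have "\<exists>A. A \<in> X \<inter> set es" "\<exists>C. C \<in> set es - X" using step.prems ne by auto
    then obtain A C where "A \<in> X \<inter> set es" "C \<in> set es - X" "q A C \<noteq> 0" using step.IH by blast
    moreover from this have "q' A C = 0" using no by auto
    ultimately show False using side step.hyps(7)[of A C] by auto
  qed
qed

section \<open>Contractibility of parts of a history\<close>

lemma contractible_cong:
  assumes "contractible S q" and "\<And>A C. A \<in> S \<Longrightarrow> C \<in> S \<Longrightarrow> q' A C = q A C"
  shows "contractible S q'"
  using assms
proof (induction arbitrary: q' rule: contractible.induct)
  case (empty q)
  then show ?case by (auto intro: contractible.empty)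
next
  case (blow_down E S q)
  show ?case
    by (rule contractible.blow_down[of E]) (use blow_down in auto)
qed

lemma contractible_image:
  assumes "contractible S q" and "inj_on f S"
    and "\<And>A C. A \<in> S \<Longrightarrow> C \<in> S \<Longrightarrow> q' (f A) (f C) = q A C"
  shows "contractible (f ` S) q'"
  using assms
proof (induction arbitrary: q' rule: contractible.induct)
  case (empty q)
  then show ?case by (auto intro: contractible.empty)
next
  case (blow_down E S q)
  have eq: "f ` S - {f E} = f ` (S - {E})" using blow_down by (auto dest: inj_onD)
  have "contractible (f ` (S - {E})) (\<lambda>A C. q' A C + q' A (f E) * q' C (f E))"
    by (rule blow_down.IH) (use blow_down in \<open>auto intro: inj_on_subset\<close>)
  then have "contractible (f ` S - {f E}) (\<lambda>A C. q' A C + q' A (f E) * q' C (f E))"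
    unfolding eq .
  moreover have "\<forall>C\<in>f ` S - {f E}. q' C (f E) \<le> 1"
    unfolding eq using blow_down.hyps(1,3) blow_down.prems(2) by auto
  moreover have "f E \<in> f ` S" "q' (f E) (f E) = -1"
    using blow_down.hyps(1,2) blow_down.prems(2) by auto
  ultimately show ?case using contractible.blow_down[of "f E" "f ` S" q'] by blast
qed

lemma contractible_minus_one_curve:
  "contractible S q \<Longrightarrow> S \<noteq> {} \<Longrightarrow> \<exists>E\<in>S. q E E = -1"
  by (erule contractible.cases) auto

text \<open>The last hypothesis says that a centre on \<open>X\<close> produces a curve of
  \<open>X\<close>. Read backwards, each blowup is undone inside \<open>X\<close>, or its centre is
  off \<open>X\<close> and the numbers on \<open>X\<close> do not change. \<open>F\<close> is the
  one curve that no blowup creates.\<close>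

lemma history_contractible:
  assumes "blowup_history F P es q" and "X \<subseteq> set es" and "F \<notin> X"
    and "\<And>s. s \<in> set es \<Longrightarrow> P s \<inter> X \<noteq> {} \<Longrightarrow> s \<in> X"
  shows "contractible X q"
  using assms
proof (induction arbitrary: X rule: blowup_history.induct)
  case (start q)
  then have "X = {}" by auto
  then show ?case by (auto intro: contractible.empty)
next
  case (step es q E q')
  have nE: "E \<notin> P s" if "s \<in> set es" for s
    using history_centre_subset[OF step.hyps(1) that] step.hyps(3) by auto
  have IH: "contractible (X - {E}) q"
  proof (rule step.IH)
    fix s assume s: "s \<in> set es" "P s \<inter> (X - {E}) \<noteq> {}"
    then show "s \<in> X - {E}" using step.prems(3)[of s] step.hyps(3) by auto
  qed (use step.prems in auto)
  show ?case
  proof (cases "E \<in> X")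
    case True
    show ?thesis
    proof (rule contractible.blow_down[OF True])
      show "contractible (X - {E}) (\<lambda>A C. q' A C + q' A E * q' C E)"
      proof (rule contractible_cong[OF IH])
        fix A C assume "A \<in> X - {E}" "C \<in> X - {E}"
        then have "A \<in> set es" "C \<in> set es" using step.prems(1) by auto
        then show "q' A C + q' A E * q' C E = q A C" using step.hyps(5,7) by simp
      qed
      show "\<forall>C\<in>X - {E}. q' C E \<le> 1"
        using step.hyps(5) step.prems(1) by force
    qed (use step.hyps in auto)
  next
    case False
    then have "P E \<inter> X = {}" using step.prems(3)[of E] by auto
    moreover have "X - {E} = X" "X \<subseteq> set es" using False step.prems(1) by auto
    ultimately show ?thesis
      using contractible_cong[OF IH, of q'] step.hyps(7) by fastforce
  qed
qed

section \<open>Infinitely near curves\<close>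

text \<open>Within a history this is the support of the total transform of \<open>c\<close>, with
  \<open>c\<close> included: a curve enters as soon as its centre lies on a member.\<close>

definition inf_near :: "('a \<Rightarrow> 'a set) \<Rightarrow> 'a \<Rightarrow> 'a set" where
  "inf_near P c = {s. (s, c) \<in> {(s, a). a \<in> P s}\<^sup>*}"

lemma inf_near_refl [simp]: "c \<in> inf_near P c"
  by (simp add: inf_near_def)

lemma inf_near_iff: "s \<in> inf_near P c \<longleftrightarrow> s = c \<or> P s \<inter> inf_near P c \<noteq> {}"
  unfolding inf_near_def by (auto elim: converse_rtranclE intro: converse_rtrancl_into_rtrancl)

lemma inf_near_mem:
  "blowup_history F P es q \<Longrightarrow> s \<in> set es \<Longrightarrow> s \<in> inf_near P c \<Longrightarrow> c \<in> set es"
proof (induction arbitrary: s rule: blowup_history.induct)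
  case (start q)
  then show ?case using inf_near_iff[of F P c] by auto
next
  case (step es q E q')
  have "P E \<subseteq> set es" using step.hyps(2) by auto
  then show ?case using step.IH step.prems inf_near_iff[of s P c] by auto
qed

lemma inf_near_before:
  assumes "blowup_history F P (xs @ z # ys) q" and "z \<in> inf_near P c" and "z \<noteq> c"
  shows "c \<in> set ys"
proof -
  obtain q0 where q0: "blowup_history F P (z # ys) q0" and sub: "P z \<subseteq> set ys"
    using history_suffix[OF assms(1)] by blast
  obtain a where a: "a \<in> P z" "a \<in> inf_near P c" using assms(2,3) inf_near_iff[of z] by auto
  have ne: "ys \<noteq> []" using a sub by auto
  then obtain q1 where "blowup_history F P ys q1" using history_tail[OF q0] by auto
  then show ?thesis using inf_near_mem[of F P ys q1 a c] a sub by auto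
qed

text \<open>Curves infinitely near to \<open>c\<close> are created after it, the curves through its
  centre before it.\<close>

lemma inf_near_centre_disjoint:
  assumes "blowup_history F P es q" and "c \<in> set es"
  shows "P c \<inter> inf_near P c = {}"
proof (rule ccontr)
  assume "\<not> ?thesis"
  then obtain a where a: "a \<in> P c" "a \<in> inf_near P c" by auto
  obtain xs ys where es: "es = xs @ c # ys" using assms(2) split_list by metis
  have h: "blowup_history F P (xs @ c # ys) q" using assms(1) es by simp
  obtain q0 where q0: "blowup_history F P (c # ys) q0" and sub: "P c \<subseteq> set ys"
    using history_suffix[OF h] by blast
  have "ys \<noteq> []" using a sub by auto
  then obtain q1 where "blowup_history F P ys q1" using history_tail[OF q0] by auto
  then have "c \<in> set ys" using inf_near_mem[of F P ys q1 a c] a sub by auto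
  then show False using history_distinct[OF q0] by auto
qed

lemma inf_near_base:
  assumes "blowup_history F P es q" and "c \<noteq> F"
  shows "F \<notin> inf_near P c"
  using assms history_base_centre inf_near_iff[of F P c] by fastforce

text \<open>Contracting the total transform of \<open>c\<close> maps it to the centre of
  \<open>c\<close>, so an outside curve that meets it passes through that centre.\<close>

lemma inf_near_neighbour:
  assumes "blowup_history F P es q" and "A \<in> set es" and "A \<notin> inf_near P c"
    and "C \<in> set es" and "C \<in> inf_near P c" and "q A C \<noteq> 0"
  shows "A \<in> P c"
  using assms
proof (induction arbitrary: A C rule: blowup_history.induct)
  case (start q)
  then show ?case by auto
next
  case (step es q E q')
  have sub: "P E \<subseteq> set es" using step.hyps(2) by auto
  consider "A = E" "C \<in> set es" | "C = E" "A \<in> set es" | "A \<in> set es" "C \<in> set es"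
    using step.prems by auto
  then show ?case
  proof cases
    case 1
    then have "C \<in> P E" using step.hyps(6) step.prems by auto
    then have "E \<in> inf_near P c" using step.prems inf_near_iff[of E] by auto
    then show ?thesis using 1 step.prems by simp
  next
    case 2
    then have A: "A \<in> P E" using step.hyps(5) step.prems by auto
    show ?thesis
    proof (cases "E = c")
      case True
      then show ?thesis using A by simp
    next
      case False
      then obtain C' where C': "C' \<in> P E" "C' \<in> inf_near P c"
        using 2 step.prems inf_near_iff[of E] by auto
      \<comment> \<open>\<open>E\<close> is therefore the blowup of the intersection point of
        \<open>A\<close> and \<open>C'\<close>, and the edge between them existed one stage
        earlier.\<close>
      then have "C' \<noteq> A" using step.prems by auto
      then have "q A C' = 1"
        using step.hyps(2) A C' history_sym[OF step.hyps(1)] by auto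
      then show ?thesis using step.IH[of A C'] 2 C' sub step.prems by auto
    qed
  next
    case 3
    have "q A C \<noteq> 0"
    proof
      assume z: "q A C = 0"
      have "A \<noteq> C" using step.prems by auto
      moreover have "A \<in> P E" "C \<in> P E" using step.prems(5) step.hyps(7)[OF 3] z by auto
      ultimately have "q A C = 1"
        using step.hyps(2) history_sym[OF step.hyps(1)] by auto
      then show False using z by simp
    qed
    then show ?thesis using step.IH 3 step.prems by blast
  qed
qed

text \<open>The total transform of \<open>c\<close> is connected: an edge destroyed by blowing up an
  intersection point is replaced by a path through the new curve, which is again infinitely near to
  \<open>c\<close>.\<close>

lemma inf_near_connected:
  assumes "blowup_history F P es q" and "c \<in> set es" and "c \<in> X"
    and "\<And>A C. A \<in> inf_near P c \<inter> set es \<inter> X \<Longrightarrow> C \<in> inf_near P c \<inter> set es - X \<Longrightarrow> q A C = 0"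
  shows "inf_near P c \<inter> set es \<subseteq> X"
  using assms
proof (induction rule: blowup_history.induct)
  case (start q)
  then show ?case by auto
next
  case (step es q E q')
  have sub: "P E \<subseteq> set es" using step.hyps(2) by auto
  have no: "q' A C = 0" if "A \<in> inf_near P c" "A \<in> insert E (set es)" "A \<in> X"
    "C \<in> inf_near P c" "C \<in> insert E (set es)" "C \<notin> X" for A C
    using step.prems(3) that by auto
  show ?case
  proof (cases "c = E")
    case True
    then have "inf_near P c \<inter> set es = {}" using inf_near_mem[OF step.hyps(1)] step.hyps(3) by auto
    then show ?thesis using True step.prems by auto
  next
    case False
    have old: "inf_near P c \<inter> set es \<subseteq> X"
    proof (rule step.IH)
      fix A C assume A: "A \<in> inf_near P c \<inter> set es \<inter> X" and C: "C \<in> inf_near P c \<inter> set es - X"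
      show "q A C = 0"
      proof (rule ccontr)
        assume "q A C \<noteq> 0"
        moreover have "q' A C = 0" using no A C by auto
        ultimately have PE: "A \<in> P E" "C \<in> P E" using step.hyps(7)[of A C] A C by auto
        then have E: "E \<in> inf_near P c" using A inf_near_iff[of E P c] by auto
        show False
        proof (cases "E \<in> X")
          case True
          then show ?thesis using no[of E C] E C step.hyps(6)[of C] PE by auto
        next
          case False
          then show ?thesis using no[of A E] E A step.hyps(5)[of A] PE by auto
        qed
      qed
    qed (use False step.prems in auto)
    have "E \<in> X" if E: "E \<in> inf_near P c"
    proof (rule ccontr)
      assume "E \<notin> X"
      obtain A where "A \<in> P E" "A \<in> inf_near P c" using E False inf_near_iff[of E] by auto
      moreover from this have "A \<in> X" using old sub by blast
      ultimately show False using sub no[of A E] step.hyps(5)[of A] E \<open>E \<notin> X\<close> by auto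
    qed
    then show ?thesis using old by auto
  qed
qed

text \<open>Undoing the blowups over \<open>c\<close> leads back to the stage where \<open>c\<close>
  was created. No infinitely near curve lies in \<open>P c\<close>, so removing \<open>c\<close>
  keeps the set closed in the sense of \<open>history_contractible\<close>.\<close>

lemma inf_near_contractible:
  assumes h: "blowup_history F P es q" and c: "c \<in> set es" "c \<noteq> F"
  shows "contractible (inf_near P c \<inter> set es - {c}) q"
proof (rule history_contractible[OF h])
  show "F \<notin> inf_near P c \<inter> set es - {c}" using inf_near_base[OF h c(2)] by auto
  fix s assume s: "s \<in> set es" "P s \<inter> (inf_near P c \<inter> set es - {c}) \<noteq> {}"
  then have "s \<in> inf_near P c" using inf_near_iff[of s P c] by auto
  moreover have "s \<noteq> c" using s inf_near_centre_disjoint[OF h c(1)] by auto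
  ultimately show "s \<in> inf_near P c \<inter> set es - {c}" using s by auto
qed auto

section \<open>Separation of the dual tree by one curve\<close>

text \<open>\<open>S\<close> and \<open>U\<close> are parts of the present tree joined only through
  \<open>z\<close>. Undoing the newer blowups creates no edge between them, since a new curve meets
  all of its centre. Just before \<open>z\<close>, an edge between them can only be the point blown
  up to \<open>z\<close>. The stage \<open>q0\<close> is chosen before \<open>S\<close> and
  \<open>U\<close>, so that several partitions can be compared at one stage.\<close>

lemma history_separation:
  assumes "blowup_history F P (xs @ z # ys) q" and "ys \<noteq> []"
  shows "\<exists>q0. blowup_history F P ys q0 \<and>
    (\<forall>S U. set xs \<union> set ys \<subseteq> S \<union> U \<longrightarrow> S \<inter> U = {} \<longrightarrow> z \<notin> S \<union> U \<longrightarrow>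
      (\<forall>A\<in>S \<inter> (set xs \<union> set ys). \<forall>C\<in>U \<inter> (set xs \<union> set ys). q A C = 0) \<longrightarrow>
      (\<forall>s\<in>set xs. (s \<in> S \<longrightarrow> P s \<inter> U = {}) \<and> (s \<in> U \<longrightarrow> P s \<inter> S = {})) \<and>
      (\<forall>A\<in>S \<inter> set ys. \<forall>C\<in>U \<inter> set ys. q0 A C \<noteq> 0 \<longrightarrow> P z = {A, C}))"
  using assms(1)
proof (induction xs arbitrary: q)
  case Nil
  then have "blowup_history F P (z # ys) q" by simp
  then show ?case
  proof (cases rule: blowup_history.cases)
    case start
    then show ?thesis using assms(2) by simp
  next
    case (step q0)
    have r: "P z = {A, C}" if "S \<inter> U = {}" "A \<in> S" "C \<in> U" "A \<in> set ys" "C \<in> set ys"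
      "q A C = 0" "q0 A C \<noteq> 0" for S U A C
    proof -
      have "A \<in> P z" "C \<in> P z" using step(7)[of A C] that by auto
      moreover have "A \<noteq> C" using that by auto
      ultimately show ?thesis using step(2) by auto
    qed
    show ?thesis
    proof (rule exI[of _ q0], rule conjI[OF step(1)], intro allI impI conjI ballI)
      fix S U A C
      assume "S \<inter> U = {}" and A: "A \<in> S \<inter> set ys" and C: "C \<in> U \<inter> set ys" and "q0 A C \<noteq> 0"
        and zero: "\<forall>A\<in>S \<inter> (set [] \<union> set ys). \<forall>C\<in>U \<inter> (set [] \<union> set ys). q A C = 0"
      moreover have "q A C = 0" using A C zero by simp
      ultimately show "P z = {A, C}" using r[of S U A C] by simp
    qed simp_all
  qed
next
  case (Cons E xs)
  then have "blowup_history F P (E # (xs @ z # ys)) q" by simp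
  then obtain q1 where h1: "blowup_history F P (xs @ z # ys) q1"
    and E: "P E \<subseteq> set (xs @ z # ys)" "E \<notin> set (xs @ z # ys)"
    and qE: "\<And>A. A \<in> set (xs @ z # ys) \<Longrightarrow> q A E = of_bool (A \<in> P E)"
            "\<And>A. A \<in> set (xs @ z # ys) \<Longrightarrow> q E A = of_bool (A \<in> P E)"
    and q: "\<And>A C. A \<in> set (xs @ z # ys) \<Longrightarrow> C \<in> set (xs @ z # ys) \<Longrightarrow>
        q A C = q1 A C - of_bool (A \<in> P E) * of_bool (C \<in> P E)"
    by (cases rule: blowup_history.cases) auto
  have zx: "z \<notin> set xs \<union> set ys" using history_distinct[OF h1] by auto
  obtain q0 where h0: "blowup_history F P ys q0" and
    IH: "\<forall>S U. set xs \<union> set ys \<subseteq> S \<union> U \<longrightarrow> S \<inter> U = {} \<longrightarrow> z \<notin> S \<union> U \<longrightarrow>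
      (\<forall>A\<in>S \<inter> (set xs \<union> set ys). \<forall>C\<in>U \<inter> (set xs \<union> set ys). q1 A C = 0) \<longrightarrow>
      (\<forall>s\<in>set xs. (s \<in> S \<longrightarrow> P s \<inter> U = {}) \<and> (s \<in> U \<longrightarrow> P s \<inter> S = {})) \<and>
      (\<forall>A\<in>S \<inter> set ys. \<forall>C\<in>U \<inter> set ys. q0 A C \<noteq> 0 \<longrightarrow> P z = {A, C})"
    using Cons.IH[OF h1] by (elim exE conjE)
  have key: "(\<forall>s\<in>set (E # xs). (s \<in> S \<longrightarrow> P s \<inter> U = {}) \<and> (s \<in> U \<longrightarrow> P s \<inter> S = {})) \<and>
      (\<forall>A\<in>S \<inter> set ys. \<forall>C\<in>U \<inter> set ys. q0 A C \<noteq> 0 \<longrightarrow> P z = {A, C})"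
    if cov: "set (E # xs) \<union> set ys \<subseteq> S \<union> U" and dis: "S \<inter> U = {}" and zSU: "z \<notin> S \<union> U"
    and zero: "\<And>A C. A \<in> S \<inter> (set (E # xs) \<union> set ys) \<Longrightarrow> C \<in> U \<inter> (set (E # xs) \<union> set ys) \<Longrightarrow> q A C = 0"
    for S U
  proof -
    \<comment> \<open>At this stage \<open>E\<close> is the newest curve and still meets every curve
      of \<open>P E\<close>.\<close>
    have PE: "(E \<in> S \<longrightarrow> P E \<inter> U = {}) \<and> (E \<in> U \<longrightarrow> P E \<inter> S = {})"
    proof (intro conjI impI equals0I)
      fix C assume "E \<in> S" "C \<in> P E \<inter> U"
      then show False using zero[of E C] qE(2)[of C] E zSU by auto
    next
      fix A assume "E \<in> U" "A \<in> P E \<inter> S"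
      then show False using zero[of A E] qE(1)[of A] E zSU by auto
    qed
    have "q1 A C = 0" if "A \<in> S \<inter> (set xs \<union> set ys)" "C \<in> U \<inter> (set xs \<union> set ys)" for A C
    proof -
      have "\<not> (A \<in> P E \<and> C \<in> P E)" using PE cov that by auto
      moreover have "q A C = 0" using zero that by auto
      ultimately show ?thesis using q[of A C] that by auto
    qed
    then have zero1: "\<forall>A\<in>S \<inter> (set xs \<union> set ys). \<forall>C\<in>U \<inter> (set xs \<union> set ys). q1 A C = 0"
      by blast
    have cov1: "set xs \<union> set ys \<subseteq> S \<union> U" using cov by auto
    note r = IH[THEN spec[of _ S], THEN spec[of _ U], THEN mp, THEN mp, THEN mp, THEN mp,
          OF cov1 dis zSU zero1]
    have "\<forall>s\<in>set (E # xs). (s \<in> S \<longrightarrow> P s \<inter> U = {}) \<and> (s \<in> U \<longrightarrow> P s \<inter> S = {})"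
    proof
      fix s assume "s \<in> set (E # xs)"
      then show "(s \<in> S \<longrightarrow> P s \<inter> U = {}) \<and> (s \<in> U \<longrightarrow> P s \<inter> S = {})"
        using PE bspec[OF conjunct1[OF r], of s] by (cases "s = E") simp_all
    qed
    then show ?thesis by (rule conjI[OF _ conjunct2[OF r]])
  qed
  show ?case
  proof (rule exI[of _ q0], rule conjI[OF h0], intro allI impI)
    fix S U
    assume a: "set (E # xs) \<union> set ys \<subseteq> S \<union> U" "S \<inter> U = {}" "z \<notin> S \<union> U"
      "\<forall>A\<in>S \<inter> (set (E # xs) \<union> set ys). \<forall>C\<in>U \<inter> (set (E # xs) \<union> set ys). q A C = 0"
    show "(\<forall>s\<in>set (E # xs). (s \<in> S \<longrightarrow> P s \<inter> U = {}) \<and> (s \<in> U \<longrightarrow> P s \<inter> S = {})) \<and>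
      (\<forall>A\<in>S \<inter> set ys. \<forall>C\<in>U \<inter> set ys. q0 A C \<noteq> 0 \<longrightarrow> P z = {A, C})"
      by (rule key[OF a(1-3)], rule a(4)[THEN bspec, THEN bspec])
  qed
qed

text \<open>Before \<open>z\<close> the tree is connected, but different colours can be joined only
  at the centre of \<open>z\<close>. Hence, if several colours are present then, each has a curve in
  \<open>P z\<close>, which has at most two elements. Curves newer than \<open>z\<close> stay on the
  side of their centre.\<close>

lemma history_colouring:
  assumes h: "blowup_history F P (xs @ z # ys) q" and z: "z \<noteq> F"
    and col: "\<And>A C. A \<in> set (xs @ ys) \<Longrightarrow> C \<in> set (xs @ ys) \<Longrightarrow> col A \<noteq> col C \<Longrightarrow> q A C = 0"
  shows history_colouring_after: "s \<in> set xs \<Longrightarrow> A \<in> P s \<Longrightarrow> A \<noteq> z \<Longrightarrow> col A = col s"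
    and history_colouring_before: "a \<in> set ys \<Longrightarrow> b \<in> set ys \<Longrightarrow> c \<in> set ys \<Longrightarrow>
      col a \<noteq> col b \<Longrightarrow> col b \<noteq> col c \<Longrightarrow> col a \<noteq> col c \<Longrightarrow> False"
proof -
  have dist: "distinct (xs @ z # ys)" using history_distinct[OF h] .
  have "F \<in> set (xs @ z # ys)" using history_base_mem[OF h] .
  have "ys \<noteq> []"
  proof
    assume "ys = []"
    then have "P z = {}" using history_suffix[OF h] by simp
    then show False using history_centre_nonempty[OF h, of z] z by simp
  qed
  from history_separation[OF h this] obtain q0 where h0: "blowup_history F P ys q0"
    and sep: "\<forall>S U. set xs \<union> set ys \<subseteq> S \<union> U \<longrightarrow> S \<inter> U = {} \<longrightarrow> z \<notin> S \<union> U \<longrightarrow>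
      (\<forall>A\<in>S \<inter> (set xs \<union> set ys). \<forall>C\<in>U \<inter> (set xs \<union> set ys). q A C = 0) \<longrightarrow>
      (\<forall>s\<in>set xs. (s \<in> S \<longrightarrow> P s \<inter> U = {}) \<and> (s \<in> U \<longrightarrow> P s \<inter> S = {})) \<and>
      (\<forall>A\<in>S \<inter> set ys. \<forall>C\<in>U \<inter> set ys. q0 A C \<noteq> 0 \<longrightarrow> P z = {A, C})"
    by (elim exE conjE)
  define S where "S k = {A. A \<noteq> z \<and> col A = k}" for k
  define U where "U k = {A. A \<noteq> z \<and> col A \<noteq> k}" for k
  have 1: "set xs \<union> set ys \<subseteq> S k \<union> U k" for k using dist unfolding S_def U_def by auto
  have 2: "S k \<inter> U k = {}" "z \<notin> S k \<union> U k" for k unfolding S_def U_def by auto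
  have 3: "\<forall>A\<in>S k \<inter> (set xs \<union> set ys). \<forall>C\<in>U k \<inter> (set xs \<union> set ys). q A C = 0" for k
  proof (intro ballI)
    fix A C assume "A \<in> S k \<inter> (set xs \<union> set ys)" "C \<in> U k \<inter> (set xs \<union> set ys)"
    then show "q A C = 0" using col[of A C] unfolding S_def U_def by auto
  qed
  note r = sep[THEN spec, THEN spec, THEN mp, THEN mp, THEN mp, THEN mp, OF 1 2 3]
  show "col A = col s" if s: "s \<in> set xs" and A: "A \<in> P s" "A \<noteq> z"
  proof (rule ccontr)
    assume "col A \<noteq> col s"
    then have "s \<in> S (col s)" "A \<in> U (col s)" using s A dist unfolding S_def U_def by auto
    moreover have "s \<in> S (col s) \<longrightarrow> P s \<inter> U (col s) = {}"
      using bspec[OF conjunct1[OF r[of "col s"]] s] by simp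
    ultimately show False using A by auto
  qed
  \<comment> \<open>Connectedness of the older stage gives an edge leaving the class of
    \<open>a\<close>. It is gone in the end, so it is the point blown up to
    \<open>z\<close>.\<close>
  have edge: "\<exists>A C. P z = {A, C} \<and> col A = col a \<and> col C \<noteq> col a"
    if "a \<in> set ys" "b \<in> set ys" "col a \<noteq> col b" for a b
  proof -
    have "z \<notin> set ys" using dist by simp
    then have "a \<in> S (col a) \<inter> set ys" "b \<in> set ys - S (col a)" using that unfolding S_def by auto
    then obtain A C where AC: "A \<in> S (col a) \<inter> set ys" "C \<in> set ys - S (col a)" "q0 A C \<noteq> 0"
      using history_connected[OF h0] by blast
    then have C: "C \<in> U (col a) \<inter> set ys" using \<open>z \<notin> set ys\<close> unfolding S_def U_def by auto
    have "P z = {A, C}"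
      using conjunct2[OF r[of "col a"], THEN bspec, OF AC(1), THEN bspec, OF C] AC(3) by simp
    then show ?thesis using AC C unfolding S_def U_def by auto
  qed
  show False if abc: "a \<in> set ys" "b \<in> set ys" "c \<in> set ys"
    "col a \<noteq> col b" "col b \<noteq> col c" "col a \<noteq> col c"
  proof -
    obtain A C where 1: "P z = {A, C}" "col A = col a" using edge[OF abc(1,2,4)] by blast
    obtain A' C' where 2: "P z = {A', C'}" "col A' = col b" using edge[OF abc(2,3,5)] by blast
    obtain A'' C'' where 3: "P z = {A'', C''}" "col A'' = col c"
      using edge[OF abc(3,1) abc(6)[symmetric]] by blast
    have "A \<in> {A, C}" "A' \<in> {A, C}" "A'' \<in> {A, C}" using 1 2 3 by auto
    then show False using 1(2) 2(2) 3(2) abc(4-6) by auto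
  qed
qed

section \<open>The intersection lattice\<close>

text \<open>The coefficient of \<open>x\<close> at the total transform of \<open>c\<close>, in the
  basis of all total transforms. At the base curve the centre is empty, and this is the plain
  coefficient.\<close>

definition coord :: "('a \<Rightarrow> 'a set) \<Rightarrow> ('a \<Rightarrow> int) \<Rightarrow> 'a \<Rightarrow> int" where
  "coord P x c = x c - sum x (P c)"

definition form :: "'a set \<Rightarrow> ('a \<Rightarrow> 'a \<Rightarrow> int) \<Rightarrow> ('a \<Rightarrow> int) \<Rightarrow> ('a \<Rightarrow> int) \<Rightarrow> int" where
  "form V q x y = (\<Sum>A\<in>V. \<Sum>C\<in>V. x A * y C * q A C)"

lemma sum_of_bool_mult:
  "finite V \<Longrightarrow> B \<subseteq> V \<Longrightarrow> (\<Sum>A\<in>V. x A * of_bool (A \<in> B)) = sum (x :: 'a \<Rightarrow> int) B"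
  by (simp add: of_bool_def if_distrib sum.If_cases Int_absorb1 Int_def[symmetric] cong: if_cong)

text \<open>Each blowup contributes one diagonal term, the product of the coordinates at the new
  curve. The base curve contributes none, because its self-intersection was 0 at the start.\<close>

lemma form_history:
  assumes "blowup_history F P es q"
  shows "form (set es) q x y = - (\<Sum>c\<in>set es - {F}. coord P x c * coord P y c)"
  using assms
proof (induction rule: blowup_history.induct)
  case (start q)
  then show ?case by (simp add: form_def)
next
  case (step es q E q')
  let ?V = "set es"
  have sub: "P E \<subseteq> ?V" using step.hyps(2) by auto
  have EF: "E \<noteq> F" using history_base_mem[OF step.hyps(1)] step.hyps(3) by auto
  have 1: "(\<Sum>C\<in>?V. x E * y C * q' E C) = x E * sum y (P E)"
  proof -
    have "(\<Sum>C\<in>?V. x E * y C * q' E C) = (\<Sum>C\<in>?V. x E * (y C * of_bool (C \<in> P E)))"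
      by (rule sum.cong) (use step.hyps(6) in auto)
    then show ?thesis using sum_of_bool_mult[of ?V "P E" y] sub by (simp flip: sum_distrib_left)
  qed
  have 2: "(\<Sum>A\<in>?V. x A * y E * q' A E) = sum x (P E) * y E"
  proof -
    have "(\<Sum>A\<in>?V. x A * y E * q' A E) = (\<Sum>A\<in>?V. (x A * of_bool (A \<in> P E)) * y E)"
      by (rule sum.cong) (use step.hyps(5) in auto)
    then show ?thesis using sum_of_bool_mult[of ?V "P E" x] sub by (simp flip: sum_distrib_right)
  qed
  have 3: "(\<Sum>A\<in>?V. \<Sum>C\<in>?V. x A * y C * q' A C) = form ?V q x y - sum x (P E) * sum y (P E)"
  proof -
    have "(\<Sum>A\<in>?V. \<Sum>C\<in>?V. x A * y C * q' A C) = (\<Sum>A\<in>?V. \<Sum>C\<in>?V. x A * y C * q A C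
        - (x A * of_bool (A \<in> P E)) * (y C * of_bool (C \<in> P E)))"
      by (intro sum.cong refl) (simp add: step.hyps(7) algebra_simps)
    also have "\<dots> = form ?V q x y
        - (\<Sum>A\<in>?V. x A * of_bool (A \<in> P E)) * (\<Sum>C\<in>?V. y C * of_bool (C \<in> P E))"
      by (simp only: form_def sum_subtractf sum_product)
    finally show ?thesis using sum_of_bool_mult[of ?V "P E"] sub by simp
  qed
  \<comment> \<open>Apart from the old form, the terms are the expansion of
    \<open>- coord P x E * coord P y E\<close>.\<close>
  have "form (set (E # es)) q' x y = - (x E * y E) + x E * sum y (P E) + sum x (P E) * y E
      + (form ?V q x y - sum x (P E) * sum y (P E))"
    using step.hyps(3,4) 1 2 3 by (simp add: form_def sum.distrib)
  moreover have "set (E # es) - {F} = insert E (set es - {F})" using EF by auto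
  ultimately show ?case
    using step.IH step.hyps(3) by (simp add: coord_def algebra_simps)
qed

text \<open>The change to these coordinates is unitriangular with respect to age.\<close>

lemma coord_inj:
  assumes "blowup_history F P es q" and "\<And>c. c \<in> set es \<Longrightarrow> coord P x c = coord P y c" and "A \<in> set es"
  shows "x A = y A"
  using assms
proof (induction arbitrary: A rule: blowup_history.induct)
  case (start q)
  then show ?case by (simp add: coord_def)
next
  case (step es q E q')
  have sub: "P E \<subseteq> set es" using step.hyps(2) by auto
  have old: "x A = y A" if "A \<in> set es" for A using step that by auto
  then have "sum x (P E) = sum y (P E)" using sub by (intro sum.cong) auto
  then have "x E = y E" using step.prems(1)[of E] by (simp add: coord_def)
  then show ?case using old step.prems by auto
qed

lemma coord_cong: "(\<And>A. A \<in> insert c (P c) \<Longrightarrow> x A = y A) \<Longrightarrow> coord P x c = coord P y c"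
  by (simp add: coord_def cong: sum.cong)

text \<open>Constructs the basis dual to the coordinates. For \<open>d = F\<close> it is the full
  fibre, whose multiplicities are all positive.\<close>

lemma total_transform:
  assumes "blowup_history F P es q" and "d \<in> set es"
  shows "\<exists>e. (\<forall>A. 0 \<le> e A) \<and> (\<forall>A. A \<notin> set es \<longrightarrow> e A = 0) \<and>
    (d = F \<longrightarrow> (\<forall>A\<in>set es. 0 < e A)) \<and> (\<forall>c\<in>set es. coord P e c = of_bool (c = d))"
  using assms
proof (induction rule: blowup_history.induct)
  case (start q)
  then show ?case by (intro exI[of _ "\<lambda>A. of_bool (A = F)"]) (auto simp: coord_def)
next
  case (step es q E q')
  have sub: "P E \<subseteq> set es" "P E \<noteq> {}" using step.hyps(2) by auto
  have fin: "finite (P E)" using sub finite_subset by fastforce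
  have EF: "E \<noteq> F" using history_base_mem[OF step.hyps(1)] step.hyps(3) by auto
  have nE: "E \<notin> insert c (P c)" if "c \<in> set es" for c
    using history_centre_subset[OF step.hyps(1) that] that step.hyps(3) by auto
  show ?case
  proof (cases "d = E")
    case True
    let ?e = "\<lambda>A. of_bool (A = E) :: int"
    have "coord P ?e c = of_bool (c = E)" if "c \<in> set es" for c
    proof -
      have "coord P ?e c = coord P (\<lambda>_. 0) c" by (rule coord_cong) (use nE[OF that] in auto)
      then show ?thesis using nE[OF that] by (auto simp: coord_def[of P "\<lambda>_. 0"])
    qed
    moreover have "sum ?e (P E) = 0" using sub step.hyps(3) by (intro sum.neutral) auto
    ultimately show ?thesis using True EF by (intro exI[of _ ?e]) (auto simp: coord_def)
  next
    case False
    then have "d \<in> set es" using step.prems by simp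
    from step.IH[OF this] obtain e where e: "\<And>A. 0 \<le> e A" "\<And>A. A \<notin> set es \<Longrightarrow> e A = 0"
      "\<And>A. d = F \<Longrightarrow> A \<in> set es \<Longrightarrow> 0 < e A" "\<And>c. c \<in> set es \<Longrightarrow> coord P e c = of_bool (c = d)"
      by (elim exE conjE) blast
    \<comment> \<open>Pullback under the blowup: the new curve gets the sum of the multiplicities
      through the centre, which makes its coordinate vanish.\<close>
    define e' where "e' A = (if A = E then sum e (P E) else e A)" for A
    have 1: "coord P e' c = of_bool (c = d)" if "c \<in> set es" for c
    proof -
      have "coord P e' c = coord P e c" by (rule coord_cong) (use nE[OF that] in \<open>auto simp: e'_def\<close>)
      then show ?thesis using e(4)[OF that] by (rule trans)
    qed
    have "sum e' (P E) = sum e (P E)"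
      using sub step.hyps(3) by (intro sum.cong) (auto simp: e'_def)
    then have 2: "coord P e' E = 0" by (simp add: coord_def e'_def)
    have 3: "0 \<le> sum e (P E)" using e(1) by (simp add: sum_nonneg)
    have 4: "0 < sum e (P E)" if "d = F" using sub fin e(3)[OF that] by (intro sum_pos) auto
    have "0 \<le> e' A" for A using e(1) 3 by (simp add: e'_def)
    moreover have "e' A = 0" if "A \<notin> set (E # es)" for A using e(2) that by (simp add: e'_def)
    moreover have "0 < e' A" if "d = F" "A \<in> set (E # es)" for A using e(3) 4 that by (auto simp: e'_def)
    moreover have "coord P e' c = of_bool (c = d)" if "c \<in> set (E # es)" for c
      using that 1 2 False by auto
    ultimately show ?thesis by blast
  qed
qed

lemma sum_of_squares_one:
  assumes "finite S" and "(\<Sum>c\<in>S. n c * n c) = (1 :: int)"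
  shows "\<exists>c\<in>S. (n c = 1 \<or> n c = -1) \<and> (\<forall>d\<in>S - {c}. n d = 0)"
proof -
  have "\<exists>c\<in>S. n c \<noteq> 0"
  proof (rule ccontr)
    assume "\<not> ?thesis"
    then have "(\<Sum>c\<in>S. n c * n c) = 0" by (intro sum.neutral) auto
    then show False using assms by simp
  qed
  then obtain c where c: "c \<in> S" "n c \<noteq> 0" by auto
  have s: "n c * n c + (\<Sum>d\<in>S - {c}. n d * n d) = 1" using assms c by (simp add: sum.remove)
  moreover have nn: "0 \<le> (\<Sum>d\<in>S - {c}. n d * n d)" by (intro sum_nonneg) auto
  moreover have pos: "1 \<le> n c * n c" using c by (auto simp: int_one_le_iff_zero_less zero_less_mult_iff)
  ultimately have "n c * n c = 1" "(\<Sum>d\<in>S - {c}. n d * n d) = 0" by auto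
  then have "n c = 1 \<or> n c = -1" "\<forall>d\<in>S - {c}. n d = 0"
    using assms(1) by (auto simp: zmult_eq_1_iff sum_nonneg_eq_0_iff)
  then show ?thesis using c by auto
qed

section \<open>Feathered fibres\<close>

lemma finite_curves: "finite (curves D)"
proof -
  have "bridges D \<subseteq> (\<lambda>(i, j). Br i j) ` (Sigma {..len D} (\<lambda>i. {1..feathers D i}))"
    unfolding bridges_def by auto
  then have "finite (bridges D)" by (rule finite_subset) auto
  moreover have "tails D \<subseteq> (\<lambda>((i, j), k). Re i j k) `
      (Sigma (Sigma {..len D} (\<lambda>i. {1..feathers D i})) (\<lambda>(i, j). {1..tail D i j}))"
    unfolding tails_def by (auto simp: image_iff)
  then have "finite (tails D)"
    by (rule finite_subset) (auto intro!: finite_imageI finite_SigmaI)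
  ultimately show ?thesis unfolding curves_def by simp
qed

lemma curves_simps [simp]:
  "Ch i \<in> curves D \<longleftrightarrow> i \<le> len D"
  "Br i j \<in> curves D \<longleftrightarrow> i \<le> len D \<and> 1 \<le> j \<and> j \<le> feathers D i"
  "Re i j k \<in> curves D \<longleftrightarrow> i \<le> len D \<and> 1 \<le> j \<and> j \<le> feathers D i \<and> 1 \<le> k \<and> k \<le> tail D i j"
  "Br i j \<in> bridges D \<longleftrightarrow> i \<le> len D \<and> 1 \<le> j \<and> j \<le> feathers D i"
  "Re i j k \<in> tails D \<longleftrightarrow> i \<le> len D \<and> 1 \<le> j \<and> j \<le> feathers D i \<and> 1 \<le> k \<and> k \<le> tail D i j"
  by (auto simp: curves_def bridges_def tails_def)

lemma curves_mem_bridges: "A \<in> bridges D \<Longrightarrow> A \<in> curves D"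
  and curves_mem_tails: "A \<in> tails D \<Longrightarrow> A \<in> curves D"
  by (auto simp: curves_def)

lemma meets_simps [simp]:
  "meets (Ch a) (Ch b) \<longleftrightarrow> b = Suc a \<or> a = Suc b"
  "meets (Ch a) (Br i j) \<longleftrightarrow> a = i"
  "meets (Br i j) (Ch a) \<longleftrightarrow> a = i"
  "meets (Ch a) (Re i j k) \<longleftrightarrow> False"
  "meets (Re i j k) (Ch a) \<longleftrightarrow> False"
  "meets (Br i j) (Br i' j') \<longleftrightarrow> False"
  "meets (Br i j) (Re i' j' k) \<longleftrightarrow> i' = i \<and> j' = j \<and> k = 1"
  "meets (Re i' j' k) (Br i j) \<longleftrightarrow> i' = i \<and> j' = j \<and> k = 1"
  "meets (Re i j k) (Re i' j' k') \<longleftrightarrow> i' = i \<and> j' = j \<and> (k' = Suc k \<or> k = Suc k')"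
  by (auto simp: meets_def joined.simps)

section \<open>Cycle groups and their homomorphisms\<close>

lemma lookup_frag_of: "Poly_Mapping.lookup (frag_of A) C = of_bool (A = C)"
  by (simp add: lookup_single when_def)

text \<open>Describes a group homomorphism by its matrix in the basis of curves; generators and
  differences suffice to prove it.\<close>

lemma hom_lookup:
  assumes "\<delta> \<in> hom (cycles D) (cycles D')" and "x \<in> carrier (cycles D)"
  shows "Poly_Mapping.lookup (\<delta> x) C =
    (\<Sum>A\<in>curves D. Poly_Mapping.lookup x A * Poly_Mapping.lookup (\<delta> (frag_of A)) C)"
proof -
  have g: "group (cycles D)" "group (cycles D')" by (simp_all add: cycles_def)
  interpret group_hom "cycles D" "cycles D'" \<delta>
    using assms(1) g by (simp add: group_hom_def group_hom_axioms_def)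
  have "Poly_Mapping.keys x \<subseteq> curves D"
    using assms(2) by (simp add: cycles_def carrier_free_Abelian_group_iff)
  then have "x \<in> carrier (cycles D) \<and> Poly_Mapping.lookup (\<delta> x) C =
    (\<Sum>A\<in>curves D. Poly_Mapping.lookup x A * Poly_Mapping.lookup (\<delta> (frag_of A)) C)"
  proof (induction x rule: frag_induction)
    case zero
    then show ?case using hom_one by (simp add: cycles_def)
  next
    case (one A)
    have "(\<Sum>B\<in>curves D. Poly_Mapping.lookup (frag_of A) B * Poly_Mapping.lookup (\<delta> (frag_of B)) C)
      = (\<Sum>B\<in>curves D. if B = A then Poly_Mapping.lookup (\<delta> (frag_of B)) C else 0)"
      by (intro sum.cong) (auto simp: lookup_frag_of)
    then show ?case using one finite_curves
      by (simp add: cycles_def carrier_free_Abelian_group_iff)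
  next
    case (diff a b)
    then have "\<delta> (a \<otimes>\<^bsub>cycles D\<^esub> inv\<^bsub>cycles D\<^esub> b) = \<delta> a \<otimes>\<^bsub>cycles D'\<^esub> inv\<^bsub>cycles D'\<^esub> \<delta> b"
      by simp
    moreover have "b \<in> carrier (cycles D)" "\<delta> b \<in> carrier (cycles D')" "a \<in> carrier (cycles D)"
      using diff by auto
    ultimately have "\<delta> (a - b) = \<delta> a - \<delta> b"
      by (simp add: cycles_def carrier_free_Abelian_group_iff)
    moreover have "a - b \<in> carrier (cycles D)"
      using diff keys_diff[of a b] by (auto simp add: cycles_def carrier_free_Abelian_group_iff)
    ultimately show ?case using diff
      by (simp add: lookup_minus left_diff_distrib sum_subtractf)
  qed
  then show ?thesis by simp
qed

definition cycle_of :: "('a \<Rightarrow> int) \<Rightarrow> 'a \<Rightarrow>\<^sub>0 int" where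
  "cycle_of e = Abs_poly_mapping e"

lemma lookup_cycle_of:
  assumes "finite V" and "\<And>A. A \<notin> V \<Longrightarrow> e A = 0"
  shows "Poly_Mapping.lookup (cycle_of e) = e"
proof -
  have "{A. e A \<noteq> 0} \<subseteq> V" using assms by auto
  then show ?thesis
    using assms(1) finite_subset lookup_Abs_poly_mapping[of e] unfolding cycle_of_def by blast
qed

lemma mem_cycles: "x \<in> carrier (cycles D) \<longleftrightarrow> (\<forall>A. A \<notin> curves D \<longrightarrow> Poly_Mapping.lookup x A = 0)"
  by (auto simp: cycles_def carrier_free_Abelian_group_iff in_keys_iff)

lemma frag_of_mem_cycles: "A \<in> curves D \<Longrightarrow> frag_of A \<in> carrier (cycles D)"
  by (simp add: cycles_def carrier_free_Abelian_group_iff)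

lemma int_number_form:
  assumes "x \<in> carrier (cycles D)" and "y \<in> carrier (cycles D)"
  shows "int_number D x y =
    form (curves D) (int_matrix D) (Poly_Mapping.lookup x) (Poly_Mapping.lookup y)"
proof -
  have k: "Poly_Mapping.keys x \<subseteq> curves D" "Poly_Mapping.keys y \<subseteq> curves D"
    using assms by (simp_all add: cycles_def carrier_free_Abelian_group_iff)
  have "int_number D x y = (\<Sum>A\<in>Poly_Mapping.keys x. \<Sum>C\<in>curves D.
        Poly_Mapping.lookup x A * Poly_Mapping.lookup y C * int_matrix D A C)"
    unfolding int_number_def
    by (intro sum.cong refl sum.mono_neutral_left finite_curves k) (auto simp: in_keys_iff)
  also have "\<dots> = form (curves D) (int_matrix D) (Poly_Mapping.lookup x) (Poly_Mapping.lookup y)"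
    unfolding form_def
    by (intro sum.mono_neutral_left finite_curves k) (auto simp: in_keys_iff intro!: sum.neutral)
  finally show ?thesis .
qed

lemma int_number_frag_of: "int_number D (frag_of A) (frag_of C) = int_matrix D A C"
  by (simp add: int_number_def lookup_frag_of)

section \<open>The lattice of one fibre in the coordinates of its history\<close>

locale fibre_history =
  fixes D :: fibre_div and P :: "curve \<Rightarrow> curve set" and es :: "curve list"
  assumes hist: "blowup_history (Ch 0) P es (int_matrix D)"
    and set_es: "set es = curves D"
begin

definition crd :: "(curve \<Rightarrow>\<^sub>0 int) \<Rightarrow> curve \<Rightarrow> int" where
  "crd x = coord P (Poly_Mapping.lookup x)"

lemma int_number_crd:
  assumes "x \<in> carrier (cycles D)" and "y \<in> carrier (cycles D)"
  shows "int_number D x y = - (\<Sum>c\<in>curves D - {Ch 0}. crd x c * crd y c)"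
  using int_number_form[OF assms] form_history[OF hist] by (simp add: set_es crd_def)

lemma crd_base: "crd x (Ch 0) = Poly_Mapping.lookup x (Ch 0)"
  using history_base_centre[OF hist] by (simp add: crd_def coord_def)

lemma crd_frag_of:
  assumes "c \<in> curves D"
  shows "crd (frag_of A) c = of_bool (A = c) - of_bool (A \<in> P c)"
proof -
  have "finite (P c)" using history_finite_centre[OF hist] assms set_es by simp
  then have "(\<Sum>B\<in>P c. of_bool (A = B)) = (of_bool (A \<in> P c) :: int)"
    by (simp add: of_bool_def)
  then show ?thesis unfolding crd_def coord_def lookup_frag_of by (rule arg_cong)
qed

lemma crd_inj:
  assumes "x \<in> carrier (cycles D)" and "y \<in> carrier (cycles D)"
    and "\<And>c. c \<in> curves D \<Longrightarrow> crd x c = crd y c"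
  shows "x = y"
proof (rule poly_mapping_eqI)
  fix A
  show "Poly_Mapping.lookup x A = Poly_Mapping.lookup y A"
    using coord_inj[OF hist, of "Poly_Mapping.lookup x" "Poly_Mapping.lookup y" A] assms
    by (cases "A \<in> curves D") (auto simp: set_es crd_def mem_cycles)
qed

lemma transform_exists:
  assumes "d \<in> curves D"
  shows "\<exists>e. e \<in> carrier (cycles D) \<and> effective e \<and>
    (d = Ch 0 \<longrightarrow> (\<forall>A\<in>curves D. 0 < Poly_Mapping.lookup e A)) \<and>
    (\<forall>c\<in>curves D. crd e c = of_bool (c = d))"
proof -
  obtain e where e: "\<forall>A. 0 \<le> e A" "\<forall>A. A \<notin> curves D \<longrightarrow> e A = 0"
    "d = Ch 0 \<longrightarrow> (\<forall>A\<in>curves D. 0 < e A)" "\<forall>c\<in>curves D. coord P e c = of_bool (c = d)"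
    using total_transform[OF hist] assms set_es by metis
  have "Poly_Mapping.lookup (cycle_of e) = e"
    using lookup_cycle_of[OF finite_curves] e(2) by blast
  then show ?thesis using e
    by (intro exI[of _ "cycle_of e"]) (simp add: crd_def mem_cycles effective_def)
qed

definition transform :: "curve \<Rightarrow> (curve \<Rightarrow>\<^sub>0 int)" where
  "transform d = (SOME e. e \<in> carrier (cycles D) \<and> effective e \<and>
    (d = Ch 0 \<longrightarrow> (\<forall>A\<in>curves D. 0 < Poly_Mapping.lookup e A)) \<and>
    (\<forall>c\<in>curves D. crd e c = of_bool (c = d)))"

lemma transform:
  assumes "d \<in> curves D"
  shows transform_mem: "transform d \<in> carrier (cycles D)"
    and transform_effective: "effective (transform d)"
    and transform_base_pos: "d = Ch 0 \<Longrightarrow> A \<in> curves D \<Longrightarrow> 0 < Poly_Mapping.lookup (transform d) A"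
    and crd_transform: "c \<in> curves D \<Longrightarrow> crd (transform d) c = of_bool (c = d)"
  using someI_ex[OF transform_exists[OF assms]] unfolding transform_def[symmetric] by auto

text \<open>The transforms are orthogonal of square -1, except the full fibre, which lies in the
  radical. So pairing with an exceptional transform reads off a coordinate.\<close>

lemma transform_number:
  assumes "d \<in> curves D" and "x \<in> carrier (cycles D)"
  shows "int_number D (transform d) x = (if d = Ch 0 then 0 else - crd x d)"
proof -
  have "(\<Sum>c\<in>curves D - {Ch 0}. crd (transform d) c * crd x c)
    = (\<Sum>c\<in>curves D - {Ch 0}. if c = d then crd x c else 0)"
    by (intro sum.cong refl) (use crd_transform[OF assms(1)] in auto)
  also have "\<dots> = (if d = Ch 0 then 0 else crd x d)"
    using assms finite_curves by auto
  finally show ?thesis using int_number_crd[OF transform_mem[OF assms(1)] assms(2)] by simp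
qed

lemma transform_number_curve:
  assumes "d \<in> curves D" and "d \<noteq> Ch 0" and "A \<in> curves D"
  shows "int_number D (transform d) (frag_of A) = of_bool (A \<in> P d) - of_bool (A = d)"
  using transform_number[OF assms(1) frag_of_mem_cycles[OF assms(3)]] assms
  by (simp add: crd_frag_of)

lemma centre_irrefl: "c \<in> curves D \<Longrightarrow> c \<notin> P c"
  using inf_near_centre_disjoint[OF hist, of c] by (auto simp: set_es)

text \<open>A total transform acquires further components only from centres on it, and the first
  such centre would lie on \<open>d\<close> itself.\<close>

lemma transform_childless:
  assumes "d \<in> curves D" and "\<And>s. s \<in> curves D \<Longrightarrow> d \<notin> P s"
  shows "transform d = frag_of d"
  by (rule crd_inj[OF transform_mem frag_of_mem_cycles])
    (use assms in \<open>auto simp: crd_transform crd_frag_of\<close>)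

text \<open>Pairing with the transforms of the exceptional curves shows that all coordinates away
  from \<open>Ch 0\<close> vanish; what is left is a multiple of the full fibre.\<close>

lemma radical:
  assumes "x \<in> carrier (cycles D)" and "\<And>y. y \<in> carrier (cycles D) \<Longrightarrow> int_number D y x = 0"
  shows "Poly_Mapping.lookup x A =
    Poly_Mapping.lookup x (Ch 0) * Poly_Mapping.lookup (transform (Ch 0)) A"
proof -
  let ?k = "Poly_Mapping.lookup x (Ch 0)" and ?f = "transform (Ch 0)"
  have F: "Ch 0 \<in> curves D" by simp
  have "frag_cmul ?k ?f \<in> carrier (cycles D)"
    using transform_mem[OF F] by (simp add: mem_cycles)
  moreover have "crd x c = crd (frag_cmul ?k ?f) c" if c: "c \<in> curves D" for c
  proof -
    have "crd (frag_cmul ?k ?f) c = ?k * crd ?f c"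
      by (simp add: crd_def coord_def sum_distrib_left right_diff_distrib)
    then have "crd (frag_cmul ?k ?f) c = ?k * of_bool (c = Ch 0)"
      using crd_transform[OF F c] by simp
    moreover have "crd x c = 0" if "c \<noteq> Ch 0"
      using transform_number[OF c assms(1)] assms(2)[OF transform_mem[OF c]] that by simp
    ultimately show ?thesis using crd_base by (cases "c = Ch 0") auto
  qed
  ultimately have "x = frag_cmul ?k ?f" by (rule crd_inj[OF assms(1)])
  then have "Poly_Mapping.lookup x A = Poly_Mapping.lookup (frag_cmul ?k ?f) A" by (rule arg_cong)
  then show ?thesis by simp
qed

lemma lookup_transform_base: "d \<in> curves D \<Longrightarrow> Poly_Mapping.lookup (transform d) (Ch 0) = of_bool (d = Ch 0)"
  using crd_transform[of d "Ch 0"] crd_base by auto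

text \<open>Integer squares with sum 1 leave one non-zero coordinate. Fixing the coefficient at
  \<open>Ch 0\<close> removes the freedom of adding multiples of the full fibre.\<close>

lemma minus_one_class:
  assumes x: "x \<in> carrier (cycles D)" and "int_number D x x = -1"
    and "Poly_Mapping.lookup x (Ch 0) = 0"
  shows "\<exists>c\<in>curves D - {Ch 0}. x = transform c \<or> x = - transform c"
proof -
  have "(\<Sum>c\<in>curves D - {Ch 0}. crd x c * crd x c) = 1"
    using int_number_crd[OF x x] assms(2) by simp
  then obtain c where c: "c \<in> curves D - {Ch 0}" "crd x c = 1 \<or> crd x c = -1"
    "\<forall>d\<in>curves D - {Ch 0} - {c}. crd x d = 0"
    using sum_of_squares_one[of "curves D - {Ch 0}"] finite_curves by blast
  have d: "crd x d = crd x c * of_bool (d = c)" if "d \<in> curves D" for d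
    using c that crd_base assms(3) by auto
  have c': "c \<in> curves D" using c by simp
  have neg: "- transform c \<in> carrier (cycles D)"
    using transform_mem[OF c'] by (simp add: mem_cycles)
  have ncrd: "crd (- transform c) d = - crd (transform c) d" for d
    by (simp add: crd_def coord_def sum_negf)
  have "x = transform c \<or> x = - transform c"
  proof (cases "crd x c = 1")
    case True
    then show ?thesis
      using crd_inj[OF x transform_mem[OF c']] d crd_transform[OF c'] by simp
  next
    case False
    then show ?thesis
      using crd_inj[OF x neg] d crd_transform[OF c'] ncrd c(2) by simp
  qed
  then show ?thesis using c by blast
qed

end

section \<open>Specializations and the coefficient at the base curve\<close>

lemma feathered_fibre_history:
  assumes "feathered_fibre D"
  obtains P es where "fibre_history D P es"
  using full_fibre_history[of "Ch 0" "blowups D" "curves D" "int_matrix D"] assms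
  unfolding feathered_fibre_def fibre_history_def by blast

lemma card_curves:
  assumes "feathered_fibre D"
  shows "card (curves D) = Suc (blowups D)"
  using full_fibre_history[of "Ch 0" "blowups D" "curves D" "int_matrix D"] assms
    history_distinct distinct_card
  unfolding feathered_fibre_def by metis

lemma (in fibre_history) int_number_sym:
  "x \<in> carrier (cycles D) \<Longrightarrow> y \<in> carrier (cycles D) \<Longrightarrow> int_number D x y = int_number D y x"
  by (simp add: int_number_crd mult.commute)

text \<open>The full fibre spans the radical and has multiplicity 1 at \<open>Ch 0\<close>, so it is
  preserved up to sign, and effectiveness fixes the sign. All its multiplicities are positive, so no
  component other than \<open>Ch 0\<close> can contribute to the coefficient at
  \<open>Ch 0\<close>.\<close>

lemma specialization_base_coefficient:
  assumes D: "feathered_fibre D" and D': "feathered_fibre D'"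
    and \<delta>: "formal_specialization D D' \<delta>" and x: "x \<in> carrier (cycles D)"
  shows "Poly_Mapping.lookup (\<delta> x) (Ch 0) = Poly_Mapping.lookup x (Ch 0)"
proof -
  obtain P es where "fibre_history D P es" using feathered_fibre_history[OF D] .
  then interpret h: fibre_history D P es .
  obtain P' es' where "fibre_history D' P' es'" using feathered_fibre_history[OF D'] .
  then interpret h': fibre_history D' P' es' .
  have hom: "\<delta> \<in> hom (cycles D) (cycles D')" and bij: "bij_betw \<delta> (carrier (cycles D)) (carrier (cycles D'))"
    using \<delta> by (auto simp: formal_specialization_def iso_def)
  have num: "int_number D' (\<delta> c) (\<delta> d) = int_number D c d"
    if "c \<in> carrier (cycles D)" "d \<in> carrier (cycles D)" for c d
    using \<delta> that by (simp add: formal_specialization_def)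
  have eff: "effective (\<delta> c)" if "c \<in> carrier (cycles D)" "effective c" for c
    using \<delta> that by (simp add: formal_specialization_def)
  have F: "Ch 0 \<in> curves D" "Ch 0 \<in> curves D'" by simp_all
  define f where "f = h.transform (Ch 0)"
  define f' where "f' = h'.transform (Ch 0)"
  have f: "f \<in> carrier (cycles D)" and f': "f' \<in> carrier (cycles D')"
    using h.transform_mem[OF F(1)] h'.transform_mem[OF F(2)] by (simp_all add: f_def f'_def)
  have maps: "\<delta> y \<in> carrier (cycles D')" if "y \<in> carrier (cycles D)" for y
    using bij that by (auto simp: bij_betw_def)
  have fF: "Poly_Mapping.lookup f (Ch 0) = 1" "Poly_Mapping.lookup f' (Ch 0) = 1"
    using h.lookup_transform_base[OF F(1)] h'.lookup_transform_base[OF F(2)]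
    by (simp_all add: f_def f'_def)
  let ?M = "\<lambda>A. Poly_Mapping.lookup (\<delta> (frag_of A)) (Ch 0)"
  define k where "k = Poly_Mapping.lookup (\<delta> f) (Ch 0)"
  have k: "k = (\<Sum>A\<in>curves D. Poly_Mapping.lookup f A * ?M A)"
    unfolding k_def by (rule hom_lookup[OF hom f])
  \<comment> \<open>The preimage of the full fibre of \<open>D'\<close>. It lies in the radical,
    hence is \<open>k'\<close> times \<open>f\<close>, and comparing coefficients at
    \<open>Ch 0\<close> gives \<open>k' * k = 1\<close>.\<close>
  obtain g where g: "g \<in> carrier (cycles D)" "f' = \<delta> g"
    using bij f' by (auto simp: bij_betw_def)
  define k' where "k' = Poly_Mapping.lookup g (Ch 0)"
  have "int_number D y g = 0" if "y \<in> carrier (cycles D)" for y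
    using h'.transform_number[OF F(2) maps[OF that]] h'.int_number_sym[OF f' maps[OF that]]
      num[OF that g(1)] g(2) by (simp add: f'_def)
  then have gk: "Poly_Mapping.lookup g A = k' * Poly_Mapping.lookup f A" for A
    unfolding f_def k'_def by (rule h.radical[OF g(1)])
  have "1 = Poly_Mapping.lookup (\<delta> g) (Ch 0)" using fF g by simp
  also have "\<dots> = (\<Sum>A\<in>curves D. Poly_Mapping.lookup g A * ?M A)"
    by (rule hom_lookup[OF hom g(1)])
  also have "\<dots> = k' * k" unfolding k gk by (simp add: sum_distrib_left mult.assoc)
  finally have "k' * k = 1" by simp
  moreover have "0 \<le> k"
    using eff[OF f] h.transform_effective[OF F(1)] by (simp add: k_def f_def effective_def)
  ultimately have k1: "k = 1" by (auto simp: zmult_eq_1_iff)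
  have M0: "?M (Ch 0) = 1"
    using \<delta> by (simp add: formal_specialization_def)
  have M_nonneg: "0 \<le> ?M A" if "A \<in> curves D" for A
    using eff[OF frag_of_mem_cycles[OF that]] by (simp add: effective_def)
  \<comment> \<open>\<open>Ch 0\<close> alone already contributes 1 to \<open>k = 1\<close>, so the
    remaining non-negative terms vanish.\<close>
  have "(\<Sum>A\<in>curves D - {Ch 0}. Poly_Mapping.lookup f A * ?M A) = 0"
    using k k1 fF M0 by (simp add: sum.remove[OF finite_curves F(1)])
  moreover have pos: "0 < Poly_Mapping.lookup f A" if "A \<in> curves D" for A
    using h.transform_base_pos[OF F(1) refl that] by (simp add: f_def)
  ultimately have "\<forall>A\<in>curves D - {Ch 0}. Poly_Mapping.lookup f A * ?M A = 0"
    using finite_curves M_nonneg by (subst (asm) sum_nonneg_eq_0_iff) (auto simp: less_imp_le)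
  then have "Poly_Mapping.lookup f A * ?M A = 0" if "A \<in> curves D - {Ch 0}" for A
    using that by (rule bspec)
  moreover have "Poly_Mapping.lookup f A \<noteq> 0" if "A \<in> curves D - {Ch 0}" for A
    using pos[of A] that by simp
  ultimately have M: "?M A = 0" if "A \<in> curves D - {Ch 0}" for A
    using that mult_eq_0_iff by metis
  have "Poly_Mapping.lookup (\<delta> x) (Ch 0) = (\<Sum>A\<in>curves D. Poly_Mapping.lookup x A * ?M A)"
    by (rule hom_lookup[OF hom x])
  also have "\<dots> = Poly_Mapping.lookup x (Ch 0)"
    using M0 M by (simp add: sum.remove[OF finite_curves F(1)])
  finally show ?thesis .
qed

text \<open>The positivity clause is chosen so that it follows from effectiveness of either
  \<open>\<delta>\<close> or its inverse; hence the notion is symmetric.\<close>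

definition lattice_iso ::
  "fibre_div \<Rightarrow> fibre_div \<Rightarrow> ((curve \<Rightarrow>\<^sub>0 int) \<Rightarrow> (curve \<Rightarrow>\<^sub>0 int)) \<Rightarrow> bool" where
  "lattice_iso D D' \<delta> \<longleftrightarrow>
     blowups D' = blowups D \<and> len D' = len D \<and>
     \<delta> \<in> hom (cycles D) (cycles D') \<and>
     bij_betw \<delta> (carrier (cycles D)) (carrier (cycles D')) \<and>
     (\<forall>c\<in>carrier (cycles D). \<forall>d\<in>carrier (cycles D).
        int_number D' (\<delta> c) (\<delta> d) = int_number D c d) \<and>
     (\<forall>c\<in>carrier (cycles D). Poly_Mapping.lookup (\<delta> c) (Ch 0) = Poly_Mapping.lookup c (Ch 0)) \<and>
     (\<forall>c\<in>carrier (cycles D). effective c \<longrightarrow> effective (- \<delta> c) \<longrightarrow> c = 0) \<and>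
     (\<forall>i\<le>len D. \<delta> (frag_of (Ch i)) = frag_of (Ch i)) \<and>
     (\<forall>i j k. Re i j k \<in> tails D \<longrightarrow>
        (\<exists>i' j'. Re i' j' k \<in> tails D' \<and> \<delta> (frag_of (Re i j k)) = frag_of (Re i' j' k))) \<and>
     (\<forall>i' j' k. Re i' j' k \<in> tails D' \<longrightarrow>
        (\<exists>i j. Re i j k \<in> tails D \<and> \<delta> (frag_of (Re i j k)) = frag_of (Re i' j' k)))"

lemma lattice_isoD:
  assumes "lattice_iso D D' \<delta>"
  shows "blowups D' = blowups D" and "len D' = len D"
    and "\<delta> \<in> hom (cycles D) (cycles D')"
    and "bij_betw \<delta> (carrier (cycles D)) (carrier (cycles D'))"
    and "\<forall>c\<in>carrier (cycles D). \<forall>d\<in>carrier (cycles D).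
        int_number D' (\<delta> c) (\<delta> d) = int_number D c d"
    and "\<forall>c\<in>carrier (cycles D). Poly_Mapping.lookup (\<delta> c) (Ch 0) = Poly_Mapping.lookup c (Ch 0)"
    and "\<forall>c\<in>carrier (cycles D). effective c \<longrightarrow> effective (- \<delta> c) \<longrightarrow> c = 0"
    and "\<forall>i\<le>len D. \<delta> (frag_of (Ch i)) = frag_of (Ch i)"
    and "\<forall>i j k. Re i j k \<in> tails D \<longrightarrow>
        (\<exists>i' j'. Re i' j' k \<in> tails D' \<and> \<delta> (frag_of (Re i j k)) = frag_of (Re i' j' k))"
    and "\<forall>i' j' k. Re i' j' k \<in> tails D' \<longrightarrow>
        (\<exists>i j. Re i j k \<in> tails D \<and> \<delta> (frag_of (Re i j k)) = frag_of (Re i' j' k))"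
proof -
  note c1 = assms[unfolded lattice_iso_def]
  note c2 = conjunct2[OF c1] note c3 = conjunct2[OF c2] note c4 = conjunct2[OF c3]
  note c5 = conjunct2[OF c4] note c6 = conjunct2[OF c5] note c7 = conjunct2[OF c6]
  note c8 = conjunct2[OF c7] note c9 = conjunct2[OF c8]
  show "blowups D' = blowups D" by (rule conjunct1[OF c1])
  show "len D' = len D" by (rule conjunct1[OF c2])
  show "\<delta> \<in> hom (cycles D) (cycles D')" by (rule conjunct1[OF c3])
  show "bij_betw \<delta> (carrier (cycles D)) (carrier (cycles D'))" by (rule conjunct1[OF c4])
  show "\<forall>c\<in>carrier (cycles D). \<forall>d\<in>carrier (cycles D).
        int_number D' (\<delta> c) (\<delta> d) = int_number D c d" by (rule conjunct1[OF c5])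
  show "\<forall>c\<in>carrier (cycles D). Poly_Mapping.lookup (\<delta> c) (Ch 0) = Poly_Mapping.lookup c (Ch 0)"
    by (rule conjunct1[OF c6])
  show "\<forall>c\<in>carrier (cycles D). effective c \<longrightarrow> effective (- \<delta> c) \<longrightarrow> c = 0"
    by (rule conjunct1[OF c7])
  show "\<forall>i\<le>len D. \<delta> (frag_of (Ch i)) = frag_of (Ch i)" by (rule conjunct1[OF c8])
  show "\<forall>i j k. Re i j k \<in> tails D \<longrightarrow>
        (\<exists>i' j'. Re i' j' k \<in> tails D' \<and> \<delta> (frag_of (Re i j k)) = frag_of (Re i' j' k))"
    by (rule conjunct1[OF c9])
  show "\<forall>i' j' k. Re i' j' k \<in> tails D' \<longrightarrow>
        (\<exists>i j. Re i j k \<in> tails D \<and> \<delta> (frag_of (Re i j k)) = frag_of (Re i' j' k))"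
    by (rule conjunct2[OF c9])
qed

lemma effective_antisym: "effective c \<Longrightarrow> effective (- c) \<Longrightarrow> c = 0"
  by (rule poly_mapping_eqI) (auto simp: effective_def intro: order_antisym)

lemma hom_cycles_uminus:
  assumes "\<delta> \<in> hom (cycles D) (cycles D')" and "x \<in> carrier (cycles D)"
  shows "\<delta> (- x) = - \<delta> x"
proof -
  have "- x \<in> carrier (cycles D)" using assms(2) by (simp add: mem_cycles)
  from hom_lookup[OF assms(1) this] hom_lookup[OF assms]
  have "Poly_Mapping.lookup (\<delta> (- x)) C = Poly_Mapping.lookup (- \<delta> x) C" for C
    by (simp only: lookup_uminus mult_minus_left sum_negf)
  then show ?thesis by (rule poly_mapping_eqI)
qed

lemma hom_cycles_zero:
  assumes "\<delta> \<in> hom (cycles D) (cycles D')"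
  shows "\<delta> 0 = 0"
proof (rule poly_mapping_eqI)
  show "Poly_Mapping.lookup (\<delta> 0) C = Poly_Mapping.lookup 0 C" for C
    by (subst hom_lookup[OF assms]) (simp_all add: mem_cycles)
qed

lemma specialization_lattice_iso:
  assumes "feathered_fibre D" and "feathered_fibre D'" and \<delta>: "formal_specialization D D' \<delta>"
  shows "lattice_iso D D' \<delta>"
proof -
  have hom: "\<delta> \<in> hom (cycles D) (cycles D')" and bij: "bij_betw \<delta> (carrier (cycles D)) (carrier (cycles D'))"
    using \<delta> by (auto simp: formal_specialization_def iso_def)
  have "c = 0" if c: "c \<in> carrier (cycles D)" "effective c" "effective (- \<delta> c)" for c
  proof -
    have "effective (\<delta> c)" using \<delta> c by (simp add: formal_specialization_def)
    then have "\<delta> c = 0" using effective_antisym c by blast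
    then have "\<delta> c = \<delta> 0" using hom_cycles_zero[OF hom] by simp
    then show ?thesis using bij c by (auto simp: bij_betw_def mem_cycles dest: inj_onD)
  qed
  then have 2: "\<forall>c\<in>carrier (cycles D). effective c \<longrightarrow> effective (- \<delta> c) \<longrightarrow> c = 0"
    by (intro ballI impI)
  have 1: "\<forall>c\<in>carrier (cycles D). Poly_Mapping.lookup (\<delta> c) (Ch 0) = Poly_Mapping.lookup c (Ch 0)"
    using specialization_base_coefficient[OF assms] by (rule ballI)
  note f1 = \<delta>[unfolded formal_specialization_def]
  note f2 = conjunct2[OF f1] note f3 = conjunct2[OF f2] note f4 = conjunct2[OF f3]
  note f5 = conjunct2[OF f4] note f6 = conjunct2[OF f5]
  show ?thesis unfolding lattice_iso_def
    by (rule conjI[OF conjunct1[OF f1] conjI[OF conjunct1[OF f2] conjI[OF hom conjI[OF bij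
          conjI[OF conjunct1[OF f4] conjI[OF 1 conjI[OF 2 f6]]]]]]])
qed

text \<open>In the positivity clause the cycle and its negative image exchange roles:
  \<open>g\<close> maps an effective \<open>- \<gamma> c\<close> to \<open>- c\<close>. The two
  clauses on the curves \<open>Re\<close> are exchanged likewise.\<close>

lemma lattice_iso_inverse:
  assumes g: "lattice_iso D' D g" and \<gamma>: "\<gamma> \<in> hom (cycles D) (cycles D')"
    and bij: "bij_betw \<gamma> (carrier (cycles D)) (carrier (cycles D'))"
    and inv: "\<And>x. x \<in> carrier (cycles D) \<Longrightarrow> g (\<gamma> x) = x" "\<And>y. y \<in> carrier (cycles D') \<Longrightarrow> \<gamma> (g y) = y"
  shows "lattice_iso D D' \<gamma>"
proof -
  note g_hom = lattice_isoD(3)[OF g]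
  have maps: "\<gamma> x \<in> carrier (cycles D')" if "x \<in> carrier (cycles D)" for x
    using bij that by (auto simp: bij_betw_def)
  have 1: "int_number D' (\<gamma> c) (\<gamma> d) = int_number D c d"
    if "c \<in> carrier (cycles D)" "d \<in> carrier (cycles D)" for c d
  proof -
    have "int_number D (g (\<gamma> c)) (g (\<gamma> d)) = int_number D' (\<gamma> c) (\<gamma> d)"
      using lattice_isoD(5)[OF g] maps that by blast
    then show ?thesis using inv that by simp
  qed
  have 2: "Poly_Mapping.lookup (\<gamma> c) (Ch 0) = Poly_Mapping.lookup c (Ch 0)"
    if "c \<in> carrier (cycles D)" for c
  proof -
    have "Poly_Mapping.lookup (g (\<gamma> c)) (Ch 0) = Poly_Mapping.lookup (\<gamma> c) (Ch 0)"
      using lattice_isoD(6)[OF g] maps that by blast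
    then show ?thesis using inv that by simp
  qed
  have 3: "c = 0" if c: "c \<in> carrier (cycles D)" "effective c" "effective (- \<gamma> c)" for c
  proof -
    have m: "- \<gamma> c \<in> carrier (cycles D')" using maps[OF c(1)] by (simp add: mem_cycles)
    have "g (- \<gamma> c) = - c" using hom_cycles_uminus[OF g_hom maps[OF c(1)]] inv(1) c by simp
    then have "- \<gamma> c = 0" using lattice_isoD(7)[OF g, rule_format, OF m] c by simp
    then have "\<gamma> c = 0" by simp
    then show ?thesis using inv(1)[OF c(1)] hom_cycles_zero[OF g_hom] by simp
  qed
  have 4: "\<gamma> (frag_of C) = frag_of A" if "g (frag_of A) = frag_of C" "A \<in> curves D'" for A C
    using inv(2)[OF frag_of_mem_cycles[OF that(2)]] that by simp
  have ch: "\<gamma> (frag_of (Ch i)) = frag_of (Ch i)" if "i \<le> len D" for i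
    using 4 lattice_isoD(2,8)[OF g] that by simp
  have re1: "\<exists>i' j'. Re i' j' k \<in> tails D' \<and> \<gamma> (frag_of (Re i j k)) = frag_of (Re i' j' k)"
    if r: "Re i j k \<in> tails D" for i j k
  proof -
    obtain i' j' where "Re i' j' k \<in> tails D'" "g (frag_of (Re i' j' k)) = frag_of (Re i j k)"
      using lattice_isoD(10)[OF g, rule_format, OF r] by (elim exE conjE)
    then show ?thesis using 4[OF _ curves_mem_tails] by blast
  qed
  have re2: "\<exists>i j. Re i j k \<in> tails D \<and> \<gamma> (frag_of (Re i j k)) = frag_of (Re i' j' k)"
    if r: "Re i' j' k \<in> tails D'" for i' j' k
  proof -
    obtain i j where "Re i j k \<in> tails D" "g (frag_of (Re i' j' k)) = frag_of (Re i j k)"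
      using lattice_isoD(9)[OF g, rule_format, OF r] by (elim exE conjE)
    then show ?thesis using 4[OF _ curves_mem_tails[OF r]] by blast
  qed
  show ?thesis unfolding lattice_iso_def
    by (intro conjI ballI allI impI) 
      (rule lattice_isoD(1,2)[OF g, symmetric] \<gamma> bij 1 2 3 ch re1 re2; assumption)+
qed

lemma generalization_lattice_iso:
  assumes "feathered_fibre D" and "feathered_fibre D'" and \<gamma>: "formal_generalization D D' \<gamma>"
  shows "lattice_iso D D' \<gamma>"
proof -
  have hom: "\<gamma> \<in> hom (cycles D) (cycles D')" and bij: "bij_betw \<gamma> (carrier (cycles D)) (carrier (cycles D'))"
    using \<gamma> by (auto simp: formal_generalization_def iso_def)
  have "lattice_iso D' D (inv_into (carrier (cycles D)) \<gamma>)"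
    using specialization_lattice_iso assms by (simp add: formal_generalization_def)
  then show ?thesis
    by (rule lattice_iso_inverse[OF _ hom bij])
      (use bij in \<open>auto simp: bij_betw_def f_inv_into_f\<close>)
qed

text \<open>The class of \<open>c\<close> has number -1 with \<open>c\<close> and a non-negative
  number with every other curve, which excludes chain and tail curves for \<open>c\<close>. The
  numbers with the chain curves determine which of them pass through the centre of \<open>c\<close>,
  so \<open>x\<close> is remembered there even if \<open>c\<close> ends up at another chain
  curve.\<close>

lemma bridge_image:
  assumes hD': "fibre_history D' P es" and \<delta>: "lattice_iso D D' \<delta>"
    and b: "Br x y \<in> bridges D" and self: "selfint D (Br x y) = -1"
  shows "\<exists>c\<in>bridges D'. \<delta> (frag_of (Br x y)) = fibre_history.transform D' P c \<and>
    (\<forall>a\<le>len D. Ch a \<in> P c \<longleftrightarrow> a = x)"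
proof -
  interpret h': fibre_history D' P es by (rule hD')
  let ?b = "frag_of (Br x y)"
  have b_cyc: "?b \<in> carrier (cycles D)"
    using frag_of_mem_cycles curves_mem_bridges[OF b] by simp
  note bij = lattice_isoD(4)[OF \<delta>]
    and len = lattice_isoD(2)[OF \<delta>] and num = lattice_isoD(5)[OF \<delta>, rule_format]
    and base = lattice_isoD(6)[OF \<delta>, rule_format] and sign = lattice_isoD(7)[OF \<delta>, rule_format]
    and ch = lattice_isoD(8)[OF \<delta>, rule_format] and re = lattice_isoD(10)[OF \<delta>, rule_format]
  have mem: "\<delta> ?b \<in> carrier (cycles D')" using bij b_cyc by (auto simp: bij_betw_def)
  have "int_number D' (\<delta> ?b) (\<delta> ?b) = -1"
    using num[OF b_cyc b_cyc] self by (simp add: int_number_frag_of int_matrix_def)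
  moreover have "Poly_Mapping.lookup (\<delta> ?b) (Ch 0) = 0" using base[OF b_cyc] by simp
  ultimately obtain c where c: "c \<in> curves D'" "c \<noteq> Ch 0"
    and pm: "\<delta> ?b = h'.transform c \<or> \<delta> ?b = - h'.transform c"
    using h'.minus_one_class[OF mem] by blast
  \<comment> \<open>The positivity clause is needed only to exclude this sign.\<close>
  have "\<delta> ?b \<noteq> - h'.transform c"
  proof
    assume "\<delta> ?b = - h'.transform c"
    then have "effective (- \<delta> ?b)" using h'.transform_effective[OF c(1)] by simp
    moreover have "effective ?b" by (simp add: effective_def)
    ultimately have "?b = 0" using sign[OF b_cyc] by blast
    then show False by simp
  qed
  then have eq: "\<delta> ?b = h'.transform c" using pm by simp
  have meet: "of_bool (C \<in> P c) - of_bool (C = c) = int_matrix D (Br x y) A"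
    if "\<delta> (frag_of A) = frag_of C" "C \<in> curves D'" "A \<in> curves D" for A C
    using num[OF b_cyc frag_of_mem_cycles[OF that(3)]] that(1) eq
      h'.transform_number_curve[OF c that(2)] int_number_frag_of by simp
  have c_ne: "C \<noteq> c" if "\<delta> (frag_of A) = frag_of C" "C \<in> curves D'" "A \<in> curves D" "A \<noteq> Br x y" for A C
    using meet[OF that(1-3)] h'.centre_irrefl[OF that(2)] that(4)
    by (auto simp: int_matrix_def of_bool_def split: if_splits)
  have "c \<in> bridges D'"
  proof (cases c)
    case (Ch a)
    then show ?thesis using c_ne[of "Ch a" "Ch a"] ch c len by auto
  next
    case (Br u v)
    then show ?thesis using c by simp
  next
    case (Re u v k)
    then have "Re u v k \<in> tails D'" using c by simp
    from re[OF this] obtain i j where "Re i j k \<in> tails D" "\<delta> (frag_of (Re i j k)) = frag_of c"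
      unfolding Re by (elim exE conjE)
    then show ?thesis using c_ne[of "Re i j k" c] c curves_mem_tails[of "Re i j k" D] by auto
  qed
  moreover have "Ch a \<in> P c \<longleftrightarrow> a = x" if "a \<le> len D" for a
  proof -
    have "c \<noteq> Ch a" using \<open>c \<in> bridges D'\<close> by (auto simp: bridges_def)
    then show ?thesis using meet[of "Ch a" "Ch a"] ch that len
      by (auto simp: int_matrix_def of_bool_def split: if_splits)
  qed
  ultimately show ?thesis using eq by blast
qed

section \<open>Bridges with infinitely near curves\<close>

definition feather :: "nat \<Rightarrow> nat \<Rightarrow> curve set" where
  "feather i j = insert (Br i j) (range (Re i j))"

text \<open>Chain curves and feathers get separate bounds because D^{>p} contains the feathers at
  \<open>Ch p\<close> but not \<open>Ch p\<close>.\<close>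

definition region :: "fibre_div \<Rightarrow> nat \<Rightarrow> nat \<Rightarrow> curve set" where
  "region D k l = {A \<in> curves D. case A of Ch x \<Rightarrow> k \<le> x | Br x y \<Rightarrow> l \<le> x | Re x y z \<Rightarrow> l \<le> x}"

text \<open>\<open>colour u v\<close> tells the part of the divisor without \<open>Ch u\<close>: the side of the chain containing
  \<open>Ch 0\<close>, the feather \<open>(u, v)\<close>, or the rest.\<close>

definition colour :: "nat \<Rightarrow> nat \<Rightarrow> curve \<Rightarrow> nat" where
  "colour u v A = (if A \<in> feather u v then 2 else
     if (case A of Ch x \<Rightarrow> x < u | Br x y \<Rightarrow> x < u | Re x y z \<Rightarrow> x < u) then 0 else 1)"

lemma feather_simps [simp]:
  "Ch a \<notin> feather i j"
  "Br u v \<in> feather i j \<longleftrightarrow> u = i \<and> v = j"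
  "Re u v k \<in> feather i j \<longleftrightarrow> u = i \<and> v = j"
  by (auto simp: feather_def)

lemma region_simps [simp]:
  "Ch a \<in> region D k l \<longleftrightarrow> Ch a \<in> curves D \<and> k \<le> a"
  "Br u v \<in> region D k l \<longleftrightarrow> Br u v \<in> curves D \<and> l \<le> u"
  "Re u v w \<in> region D k l \<longleftrightarrow> Re u v w \<in> curves D \<and> l \<le> u"
  by (auto simp: region_def)

lemma region_subset: "region D k l \<subseteq> curves D"
  by (auto simp: region_def)

lemma colour_meets: "A \<noteq> Ch u \<Longrightarrow> C \<noteq> Ch u \<Longrightarrow> colour u v A \<noteq> colour u v C \<Longrightarrow> \<not> meets A C"
  by (cases A; cases C) (auto simp: colour_def split: if_splits)

section \<open>Age of the curves\<close>

context fibre_history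
begin

abbreviation near :: "curve \<Rightarrow> curve set" where "near \<equiv> inf_near P"

text \<open>The list is newest first, so what follows \<open>z\<close> was created before
  it.\<close>

definition older :: "curve \<Rightarrow> curve set" where
  "older z = set (tl (dropWhile (\<lambda>A. A \<noteq> z) es))"

lemma distinct_es: "distinct es"
  using history_distinct[OF hist] .

lemma older_split:
  assumes "es = xs @ z # ys"
  shows "older z = set ys"
proof -
  have "z \<notin> set xs" using distinct_es assms by auto
  then have "dropWhile (\<lambda>A. A \<noteq> z) es = z # ys" unfolding assms
    by (subst dropWhile_append2) auto
  then show ?thesis by (simp add: older_def)
qed

lemma splitE:
  assumes "z \<in> curves D"
  obtains xs ys where "es = xs @ z # ys" "older z = set ys" "curves D = set xs \<union> insert z (set ys)"
    "z \<notin> set xs" "z \<notin> set ys" "set xs \<inter> set ys = {}"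
proof -
  obtain xs ys where s: "es = xs @ z # ys" using assms set_es split_list by metis
  have "curves D = set xs \<union> insert z (set ys)" using set_es[symmetric] s by auto
  moreover have "distinct (xs @ z # ys)" using distinct_es s by simp
  ultimately show ?thesis using that[OF s older_split[OF s]] by simp
qed

lemma not_older_self: "z \<in> curves D \<Longrightarrow> z \<notin> older z"
  by (elim splitE) simp

lemma older_trans:
  assumes "b \<in> older c" and "c \<in> curves D" and "a \<in> older b"
  shows "a \<in> older c"
proof -
  obtain xs ys where s: "es = xs @ c # ys" "older c = set ys"
    "curves D = set xs \<union> insert c (set ys)" "c \<notin> set xs" "c \<notin> set ys" "set xs \<inter> set ys = {}"
    by (rule splitE[OF assms(2)])
  then obtain ys1 ys2 where y: "ys = ys1 @ b # ys2" using assms(1) split_list by metis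
  have "older b = set ys2" using older_split[of "xs @ c # ys1" b ys2] s y by simp
  then show ?thesis using assms(3) s y by simp
qed

lemma older_near: "z \<in> near c \<Longrightarrow> z \<noteq> c \<Longrightarrow> z \<in> curves D \<Longrightarrow> c \<in> older z"
proof -
  assume z: "z \<in> near c" "z \<noteq> c" "z \<in> curves D"
  obtain xs ys where s: "es = xs @ z # ys" "older z = set ys"
    "curves D = set xs \<union> insert z (set ys)" "z \<notin> set xs" "z \<notin> set ys" "set xs \<inter> set ys = {}"
    by (rule splitE[OF z(3)])
  show ?thesis using inf_near_before[of "Ch 0" P xs z ys "int_matrix D" c] hist z s by simp
qed

lemma older_centre: "A \<in> P z \<Longrightarrow> z \<in> curves D \<Longrightarrow> A \<in> older z"
proof -
  assume z: "A \<in> P z" "z \<in> curves D"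
  obtain xs ys where s: "es = xs @ z # ys" "older z = set ys"
    "curves D = set xs \<union> insert z (set ys)" "z \<notin> set xs" "z \<notin> set ys" "set xs \<inter> set ys = {}"
    by (rule splitE[OF z(2)])
  show ?thesis using history_suffix[of "Ch 0" P xs z ys "int_matrix D"] hist z s by auto
qed

lemma older_base:
  assumes "z \<in> curves D" and "z \<noteq> Ch 0"
  shows "Ch 0 \<in> older z"
proof -
  obtain xs ys where s: "es = xs @ z # ys" "older z = set ys"
    "curves D = set xs \<union> insert z (set ys)" "z \<notin> set xs" "z \<notin> set ys" "set xs \<inter> set ys = {}"
    by (rule splitE[OF assms(1)])
  have h: "blowup_history (Ch 0) P (xs @ z # ys) (int_matrix D)" using hist s by simp
  obtain q0 where q0: "blowup_history (Ch 0) P (z # ys) q0"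
    using history_suffix[OF h] by (elim conjE exE)
  then show ?thesis using history_base_mem[OF q0] assms(2) s by auto
qed

lemma colour_older:
  assumes "0 < u" and "u \<le> len D" and "a \<in> older (Ch u)" and "a \<in> feather u v"
    and "b \<in> older (Ch u)" and "colour u v b = 1"
  shows False
proof -
  have z: "Ch u \<in> curves D" "Ch u \<noteq> Ch 0" using assms by auto
  obtain xs ys where s: "es = xs @ Ch u # ys" "older (Ch u) = set ys"
    "curves D = set xs \<union> insert (Ch u) (set ys)" "Ch u \<notin> set xs" "Ch u \<notin> set ys" "set xs \<inter> set ys = {}"
    by (rule splitE[OF z(1)])
  have h: "blowup_history (Ch 0) P (xs @ Ch u # ys) (int_matrix D)" using hist s by simp
  have col: "int_matrix D A C = 0"
    if "A \<in> set (xs @ ys)" "C \<in> set (xs @ ys)" "colour u v A \<noteq> colour u v C" for A C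
    using colour_meets[of A u C v] that s by (auto simp: int_matrix_def)
  have "colour u v a = 2" "colour u v (Ch 0) = 0" using assms by (auto simp: colour_def)
  then have "colour u v a \<noteq> colour u v b" "colour u v b \<noteq> colour u v (Ch 0)"
    "colour u v a \<noteq> colour u v (Ch 0)" using assms(6) by simp_all
  moreover have ys: "a \<in> set ys" "b \<in> set ys" "Ch 0 \<in> set ys"
    using assms(3,5) older_base[OF z] unfolding s(2) .
  ultimately show False
    by (intro history_colouring_before[where col = "colour u v", OF h z(2) _ ys] col)
qed

lemma colour_after:
  assumes "0 < u" and "u \<le> len D" and "s \<in> curves D" and "s \<notin> older (Ch u)" and "s \<noteq> Ch u"
    and "A \<in> P s" and "A \<noteq> Ch u"
  shows "colour u v A = colour u v s"
proof -
  have z: "Ch u \<in> curves D" "Ch u \<noteq> Ch 0" using assms by auto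
  obtain xs ys where s: "es = xs @ Ch u # ys" "older (Ch u) = set ys"
    "curves D = set xs \<union> insert (Ch u) (set ys)" "Ch u \<notin> set xs" "Ch u \<notin> set ys" "set xs \<inter> set ys = {}"
    by (rule splitE[OF z(1)])
  have h: "blowup_history (Ch 0) P (xs @ Ch u # ys) (int_matrix D)" using hist s by simp
  have col: "int_matrix D A C = 0"
    if "A \<in> set (xs @ ys)" "C \<in> set (xs @ ys)" "colour u v A \<noteq> colour u v C" for A C
    using colour_meets[of A u C v] that s by (auto simp: int_matrix_def)
  have sx: "s \<in> set xs" using assms(3-5) unfolding s(2,3) by blast
  show ?thesis
    by (rule history_colouring_after[where col = "colour u v", OF h z(2) _ sx assms(6,7)]) (rule col)
qed

lemma neighbour_centre:
  assumes "A \<in> curves D" and "A \<notin> near c" and "C \<in> curves D" and "C \<in> near c" and "meets A C"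
  shows "A \<in> P c"
  using inf_near_neighbour[OF hist, of A c C] assms
  by (cases "A = C") (auto simp: set_es int_matrix_def)

text \<open>Both bridges would be older than \<open>Ch p2\<close>. One lies in the feather
  \<open>(p2, q2)\<close>, the other has colour 1 because \<open>p2 \<le> p1\<close>; this
  contradicts \<open>colour_older\<close>.\<close>

lemma jump_unique:
  assumes "0 < p2" and "p2 \<le> p1" and "p2 \<le> len D" and "Br p1 q1 \<noteq> Br p2 q2"
    and "Ch p2 \<in> near (Br p1 q1)" and "Ch p2 \<in> near (Br p2 q2)"
  shows False
  using colour_older[of p2 "Br p2 q2" q2 "Br p1 q1"] older_near[of "Ch p2"] assms
  by (auto simp: colour_def)

end

section \<open>Bridges that carry the centre of a later blowup\<close>

locale feathered_history = fibre_history +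
  assumes tails_self: "A \<in> tails D \<Longrightarrow> selfint D A \<le> -2"
begin

text \<open>A non-empty contractible configuration contains a (-1)-curve, and tails contain
  none.\<close>

lemma contractible_tails:
  assumes "contractible X (int_matrix D)" and "X \<subseteq> tails D"
  shows "X = {}"
  using contractible_minus_one_curve[OF assms(1)] assms(2) tails_self by (force simp: int_matrix_def)

context
  fixes p q i s
  assumes c: "Br p q \<in> curves D" and s: "s \<in> curves D" "Br p q \<in> P s"
    and centre: "\<And>a. a \<le> len D \<Longrightarrow> Ch a \<in> P (Br p q) \<longleftrightarrow> a = i" and i: "i \<le> len D"
begin

text \<open>\<open>Br p q\<close> is created on \<open>Ch i\<close>, the only chain curve through
  its centre, and \<open>s\<close> is blown up on it later. Its connected total transform can leave
  the feather only through \<open>Ch p\<close>; otherwise it would add just a contractible set of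
  tail curves. Where nearness changes along the chain, the curve that is not near passes through the
  centre, so it is \<open>Ch i\<close>.\<close>

lemma jump_chain:
  shows jump_chain_mem: "Ch p \<in> near (Br p q)" and jump_less: "i < p"
    and jump_chain_after: "i < a \<Longrightarrow> a \<le> len D \<Longrightarrow> Ch a \<in> near (Br p q)"
proof -
  have s_near: "s \<in> near (Br p q)" using inf_near_iff[of s P "Br p q"] s by auto
  have s_ne: "s \<noteq> Br p q" using centre_irrefl[OF c] s by auto
  show p_mem: "Ch p \<in> near (Br p q)"
  proof (rule ccontr)
    assume n: "Ch p \<notin> near (Br p q)"
    have "near (Br p q) \<inter> set es \<subseteq> feather p q"
    proof (rule inf_near_connected[OF hist])
      fix A C assume "A \<in> near (Br p q) \<inter> set es \<inter> feather p q" "C \<in> near (Br p q) \<inter> set es - feather p q"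
      then show "int_matrix D A C = 0" using n
        by (cases A; cases C) (auto simp: int_matrix_def)
    qed (use c set_es in auto)
    then have sub: "near (Br p q) \<inter> curves D - {Br p q} \<subseteq> tails D"
      unfolding set_es by (auto simp: feather_def)
    have "contractible (near (Br p q) \<inter> curves D - {Br p q}) (int_matrix D)"
      using inf_near_contractible[OF hist, of "Br p q"] c set_es by simp
    then have "near (Br p q) \<inter> curves D - {Br p q} = {}" using contractible_tails sub by blast
    then show False using s_near s_ne s by auto
  qed
  \<comment> \<open>Going up from \<open>Ch 0\<close>, nearness can begin only after
    \<open>Ch i\<close>.\<close>
  have low: "Ch a \<notin> near (Br p q)" if "a \<le> i" for a
    using that
  proof (induction a)
    case 0
    then show ?case using inf_near_base[OF hist, of "Br p q"] by auto
  next
    case (Suc a)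
    have "Ch (Suc a) \<in> near (Br p q) \<Longrightarrow> Ch a \<in> P (Br p q)"
      by (rule neighbour_centre[of "Ch a" _ "Ch (Suc a)"]) (use Suc i in auto)
    then show ?case using centre[of a] Suc i by auto
  qed
  then show ip: "i < p" using p_mem not_le by blast
  have link: "Ch a \<in> near (Br p q) \<longleftrightarrow> Ch (Suc a) \<in> near (Br p q)" if "i < a" "a < len D" for a
  proof -
    have "Ch (Suc a) \<in> P (Br p q)" if "Ch a \<in> near (Br p q)" "Ch (Suc a) \<notin> near (Br p q)"
      by (rule neighbour_centre[of "Ch (Suc a)" _ "Ch a"]) (use that \<open>a < len D\<close> in auto)
    moreover have "Ch a \<in> P (Br p q)" if "Ch (Suc a) \<in> near (Br p q)" "Ch a \<notin> near (Br p q)"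
      by (rule neighbour_centre[of "Ch a" _ "Ch (Suc a)"]) (use that \<open>a < len D\<close> in auto)
    ultimately show ?thesis using centre[of a] centre[of "Suc a"] that by auto
  qed
  have pl: "p \<le> len D" using c by simp
  show "Ch a \<in> near (Br p q)" if "i < a" "a \<le> len D"
  proof (cases "a \<le> p")
    case True
    then show ?thesis using that(1)
    proof (induction a rule: inc_induct)
      case base
      then show ?case using p_mem by simp
    next
      case (step n)
      then show ?case using link[of n] pl by auto
    qed
  next
    case False
    then have "p \<le> a" by simp
    then show ?thesis using that(2)
    proof (induction a rule: dec_induct)
      case base
      then show ?case using p_mem by simp
    next
      case (step n)
      then show ?case using link[of n] ip by auto
    qed
  qed
qed

text \<open>\<open>Ch p\<close> is infinitely near to the bridge, hence newer. By
  \<open>colour_older\<close> all curves of colour 1 are then newer than \<open>Ch p\<close>, and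
  blowups on them stay in that part.\<close>

lemma jump_region_contractible:
  "contractible (region D (Suc p) p - feather p q) (int_matrix D)"
proof -
  have p: "0 < p" "p \<le> len D" using jump_less c by auto
  have z: "Ch p \<in> curves D" using p by simp
  have c_older: "Br p q \<in> older (Ch p)" using older_near[OF jump_chain_mem _ z] by simp
  have eq: "region D (Suc p) p - feather p q = {A \<in> curves D - {Ch p}. colour p q A = 1}" (is "_ = ?X")
  proof (rule Set.set_eqI)
    show "A \<in> region D (Suc p) p - feather p q \<longleftrightarrow> A \<in> ?X" for A
      by (cases A) (auto simp: colour_def)
  qed
  have no: "A \<notin> older (Ch p)" if "colour p q A = 1" for A
    using colour_older[OF p c_older, of q A] that by auto
  show ?thesis unfolding eq
  proof (rule history_contractible[OF hist])
    \<comment> \<open>\<open>A\<close> is newer than \<open>Ch p\<close> and older than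
      \<open>t\<close>, so \<open>t\<close> is newer than \<open>Ch p\<close> too and
      \<open>colour_after\<close> applies.\<close>
    fix t assume t: "t \<in> set es" "P t \<inter> ?X \<noteq> {}"
    then obtain A where A: "A \<in> P t" "A \<in> ?X" by auto
    have t': "t \<in> curves D" using t set_es by simp
    have At: "A \<in> older t" using older_centre[OF A(1) t'] .
    have "t \<noteq> Ch p" using no[of A] At A by auto
    moreover have "t \<notin> older (Ch p)" using older_trans[OF _ z At] no[of A] A by auto
    ultimately show "t \<in> ?X" using colour_after[OF p t', of A q] A t' by auto
  next
    show "?X \<subseteq> set es" using set_es by auto
    show "Ch 0 \<notin> ?X" using p by (auto simp: colour_def)
  qed
qed

text \<open>The set equals the curves infinitely near to the bridge, without the bridge itself. The
  other feathers are included because all chain curves after \<open>Ch i\<close> are near. The only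
  exit from the region is \<open>Ch i\<close>, which lies in the centre and is not near. The own
  tail is excluded by self-intersection.\<close>

lemma jump_last_contractible:
  assumes n: "p = len D"
  shows "contractible (region D (Suc i) (Suc i) - feather p q) (int_matrix D)"
proof -
  let ?c = "Br p q" and ?R = "region D (Suc i) (Suc i)"
  have feather_near: "A \<in> near ?c"
    if A: "A \<in> curves D" "A \<in> feather u v" "i < u" "(u, v) \<noteq> (p, q)"
      and C: "C \<in> curves D" "C \<in> near ?c" "meets A C" for A C u v
  proof (rule ccontr)
    assume "A \<notin> near ?c"
    then have "A \<in> P ?c" using neighbour_centre A C by blast
    then have "A \<in> older ?c" using older_centre c by blast
    \<comment> \<open>As \<open>p\<close> is the last index, the bridge is attached at or beyond
      \<open>Ch u\<close> and has colour 1 with respect to the feather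
      \<open>(u, v)\<close>.\<close>
    moreover have u: "u \<le> p" using A n by (auto simp: feather_def)
    moreover have "?c \<in> older (Ch u)" using older_near[of "Ch u" ?c] jump_chain_after[of u] A u n by simp
    ultimately have "A \<in> older (Ch u)" using older_trans[of ?c "Ch u" A] n by simp
    then show False
      using colour_older[of u A v ?c] \<open>?c \<in> older (Ch u)\<close> A u n by (auto simp: colour_def)
  qed
  have ch: "Ch a \<in> near ?c" if "i < a" "a \<le> len D" for a using jump_chain_after that by blast
  have br: "Br u v \<in> near ?c" if "Br u v \<in> curves D" "i < u" for u v
  proof (cases "(u, v) = (p, q)")
    case False
    then show ?thesis using feather_near[of "Br u v" u v "Ch u"] ch that by auto
  qed simp
  have re: "Re u v k \<in> near ?c" if "Re u v k \<in> curves D" "i < u" "(u, v) \<noteq> (p, q)" for u v k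
    using that(1)
  proof (induction k)
    case 0
    then show ?case by simp
  next
    case (Suc k)
    show ?case
    proof (cases k)
      case 0
      then show ?thesis using feather_near[of "Re u v 1" u v "Br u v"] br[of u v] Suc.prems that by auto
    next
      case (Suc l)
      then show ?thesis
        using feather_near[of "Re u v (Suc k)" u v "Re u v k"] Suc.IH Suc.prems that by auto
    qed
  qed
  have sub1: "?R - feather p q \<subseteq> near ?c \<inter> curves D - {?c}"
  proof
    fix A assume "A \<in> ?R - feather p q"
    then show "A \<in> near ?c \<inter> curves D - {?c}" using ch br re by (cases A) auto
  qed
  have in_R: "near ?c \<inter> set es \<subseteq> ?R"
  proof (rule inf_near_connected[OF hist])
    have "Ch i \<notin> near ?c"
      using inf_near_centre_disjoint[OF hist, of ?c] c centre[OF i] set_es by auto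
    fix A C assume A: "A \<in> near ?c \<inter> set es \<inter> ?R" and C: "C \<in> near ?c \<inter> set es - ?R"
    have "A \<in> ?R" "C \<in> curves D" "C \<notin> ?R" using A C set_es by auto
    then have "C = Ch i" if "meets A C" using that by (cases A; cases C) auto
    then have "\<not> meets A C" using C \<open>Ch i \<notin> near ?c\<close> by blast
    moreover have "A \<noteq> C" using A C by blast
    ultimately show "int_matrix D A C = 0" by (simp add: int_matrix_def)
  qed (use c set_es jump_less in auto)
  \<comment> \<open>The bridge separates its tail from everything else, so later centres on the tail
    produce tail curves. The near tail curves are thus contractible on their own.\<close>
  have no_tail: "near ?c \<inter> curves D \<inter> range (Re p q) = {}" (is "?X = {}")
  proof (rule contractible_tails)
    show "?X \<subseteq> tails D" by auto
    show "contractible ?X (int_matrix D)"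
    proof (rule history_contractible[OF hist])
      fix t assume t: "t \<in> set es" "P t \<inter> ?X \<noteq> {}"
      then obtain A where A: "A \<in> P t" "A \<in> near ?c" "A \<in> range (Re p q)" by auto
      have t': "t \<in> curves D" using t set_es by simp
      have tn: "t \<in> near ?c" using inf_near_iff[of t] A by auto
      have "t \<noteq> ?c" using inf_near_centre_disjoint[OF hist, of ?c] A c set_es by auto
      then have "?c \<in> older t" using older_near tn t' by blast
      then have "t \<notin> older ?c" using older_trans[of t ?c ?c] not_older_self c by blast
      obtain xs ys where sp: "es = xs @ ?c # ys" "older ?c = set ys"
    "curves D = set xs \<union> insert ?c (set ys)" "?c \<notin> set xs" "?c \<notin> set ys" "set xs \<inter> set ys = {}"
    by (rule splitE[OF c])
      have h: "blowup_history (Ch 0) P (xs @ ?c # ys) (int_matrix D)" using hist sp by simp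
      have col: "int_matrix D A C = 0"
        if "A \<in> set (xs @ ys)" "C \<in> set (xs @ ys)"
          "(A \<in> range (Re p q)) \<noteq> (C \<in> range (Re p q))" for A C
      proof -
        have "A \<noteq> ?c" "C \<noteq> ?c" using that sp by auto
        then show ?thesis using that(3) by (cases A; cases C) (auto simp: int_matrix_def)
      qed
      have tx: "t \<in> set xs" using t' \<open>t \<noteq> ?c\<close> \<open>t \<notin> older ?c\<close> unfolding sp(2,3) by blast
      have Ac: "A \<noteq> ?c" and c0: "?c \<noteq> Ch 0" using A by auto
      have "(A \<in> range (Re p q)) = (t \<in> range (Re p q))"
        by (rule history_colouring_after[where col = "\<lambda>A. A \<in> range (Re p q)", OF h c0 _ tx A(1) Ac])
          (rule col)
      then show "t \<in> ?X" using A tn t' by auto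
    qed (use set_es in auto)
  qed
  have "near ?c \<inter> curves D - {?c} \<subseteq> ?R - feather p q"
    using in_R no_tail set_es by (auto simp: feather_def)
  then have "near ?c \<inter> curves D - {?c} = ?R - feather p q" using sub1 by auto
  then show ?thesis using inf_near_contractible[OF hist, of ?c] c set_es by simp
qed

end

end

section \<open>The divisors after a chain curve\<close>

lemma component_self: "A \<in> S \<Longrightarrow> A \<in> component_of S A"
  by (simp add: component_of_def)

lemma component_step:
  "C \<in> component_of S A \<Longrightarrow> C' \<in> S \<Longrightarrow> meets C C' \<Longrightarrow> C' \<in> component_of S A"
  unfolding component_of_def by (auto intro: rtrancl_into_rtrancl)

lemma component_subset:
  assumes "A \<in> X" and "\<And>B C. B \<in> X \<Longrightarrow> C \<in> S \<Longrightarrow> meets B C \<Longrightarrow> C \<in> X"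
  shows "component_of S A \<subseteq> X"
proof
  fix C assume "C \<in> component_of S A"
  then have "(A, C) \<in> {(X, Y). X \<in> S \<and> Y \<in> S \<and> meets X Y}\<^sup>*" by (simp add: component_of_def)
  then show "C \<in> X" by induction (use assms in auto)
qed

text \<open>Curves attached before \<open>Ch p\<close> reach \<open>Ch 0\<close> by walking down the
  feather and the chain without using \<open>Ch p\<close>; the region has no neighbour outside
  itself other than \<open>Ch p\<close>.\<close>

lemma div_gt_region:
  assumes "1 \<le> p" and "p \<le> len D"
  shows "div_gt D p = region D (Suc p) p"
proof
  let ?S = "curves D - {Ch p}"
  show "region D (Suc p) p \<subseteq> div_gt D p"
  proof
    fix A assume A: "A \<in> region D (Suc p) p"
    then have AS: "A \<in> ?S" using region_subset by auto
    have "component_of ?S A \<subseteq> region D (Suc p) p"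
    proof (rule component_subset[OF A])
      fix B C assume "B \<in> region D (Suc p) p" "C \<in> ?S" "meets B C"
      then show "C \<in> region D (Suc p) p" by (cases B; cases C) auto
    qed
    then have "Ch 0 \<notin> component_of ?S A" by auto
    then show "A \<in> div_gt D p" unfolding div_gt_def using component_self[OF AS] AS by blast
  qed
  show "div_gt D p \<subseteq> region D (Suc p) p"
  proof
    fix C assume "C \<in> div_gt D p"
    then obtain A where A: "A \<in> ?S" "C \<in> component_of ?S A" "Ch 0 \<notin> component_of ?S A"
      unfolding div_gt_def by blast
    let ?K = "component_of ?S A"
    have step: "B' \<in> ?K" if "B \<in> ?K" "B' \<in> ?S" "meets B B'" for B B'
      using component_step that by blast
    have ch: "Ch x \<notin> ?K" if "x < p" for x
      using that
    proof (induction x)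
      case 0
      then show ?case using A by simp
    next
      case (Suc x)
      then show ?case using step[of "Ch (Suc x)" "Ch x"] assms by auto
    qed
    have br: "Br x y \<notin> ?K" if "x < p" for x y
      using step[of "Br x y" "Ch x"] ch[OF that] that assms by auto
    have re: "Re x y k \<notin> ?K" if "x < p" for x y k
    proof (induction k)
      case 0
      then show ?case by (auto simp: component_of_def)
    next
      case (Suc k)
      show ?case
      proof
        assume K: "Re x y (Suc k) \<in> ?K"
        then have m: "Re x y (Suc k) \<in> curves D" by (auto simp: component_of_def)
        show False
        proof (cases k)
          case 0
          then show ?thesis using step[of "Re x y 1" "Br x y"] br[OF that] K m by auto
        next
          case (Suc l)
          then show ?thesis using step[of "Re x y (Suc k)" "Re x y k"] Suc.IH K m by auto
        qed
      qed
    qed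
    have CS: "C \<in> curves D" "C \<noteq> Ch p" using A(2) by (auto simp: component_of_def)
    show "C \<in> region D (Suc p) p"
    proof (cases C)
      case (Ch x)
      then have "\<not> x < p" "x \<noteq> p" using ch[of x] A(2) CS by auto
      then show ?thesis using Ch CS by simp
    next
      case (Br x y)
      then have "\<not> x < p" using br[of x y] A(2) by auto
      then show ?thesis using Br CS by simp
    next
      case (Re x y k)
      then have "\<not> x < p" using re[of x y k] A(2) by auto
      then show ?thesis using Re CS by simp
    qed
  qed
qed

lemma div_ge_region:
  assumes "i < len D"
  shows "div_ge D (i + 1) = region D (Suc i) (Suc i)"
proof
  let ?S = "curves D - {Ch i}" and ?R = "region D (Suc i) (Suc i)"
  let ?K = "component_of ?S (Ch (Suc i))"
  have eq: "div_ge D (i + 1) = ?K" by (simp add: div_ge_def)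
  have "?K \<subseteq> ?R"
  proof (rule component_subset)
    show "Ch (Suc i) \<in> ?R" using assms by simp
    fix B C assume "B \<in> ?R" "C \<in> ?S" "meets B C"
    then show "C \<in> ?R" by (cases B; cases C) auto
  qed
  then show "div_ge D (i + 1) \<subseteq> ?R" using eq by simp
  have step: "B' \<in> ?K" if "B \<in> ?K" "B' \<in> ?S" "meets B B'" for B B'
    using component_step that by blast
  have ch: "Ch x \<in> ?K" if "Suc i \<le> x" "x \<le> len D" for x
    using that
  proof (induction x rule: dec_induct)
    case base
    then show ?case by (intro component_self) simp
  next
    case (step n)
    then show ?case using component_step[of "Ch n" ?S "Ch (Suc i)" "Ch (Suc n)"] by auto
  qed
  have br: "Br x y \<in> ?K" if "Suc i \<le> x" "Br x y \<in> curves D" for x y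
    using step[of "Ch x" "Br x y"] ch[of x] that by auto
  have re: "Re x y k \<in> ?K" if "Suc i \<le> x" "Re x y k \<in> curves D" for x y k
    using that(2)
  proof (induction k)
    case 0
    then show ?case by simp
  next
    case (Suc k)
    show ?case
    proof (cases k)
      case 0
      then show ?thesis using step[of "Br x y" "Re x y 1"] br[OF that(1), of y] Suc.prems by auto
    next
      case (Suc l)
      then show ?thesis using step[of "Re x y k" "Re x y (Suc k)"] Suc.IH Suc.prems by auto
    qed
  qed
  show "?R \<subseteq> div_ge D (i + 1)"
  proof
    fix C assume "C \<in> ?R"
    then show "C \<in> div_ge D (i + 1)" unfolding eq using ch br re by (cases C) auto
  qed
qed

section \<open>Rigidity\<close>

text \<open>The combinatorial trace of \<open>\<delta>\<close>; the history is that of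
  \<open>D'\<close>. A bridge goes to the curve \<open>c\<close> whose class e_c is its image, every
  other curve to its image. Numbers are preserved only where e_c is the curve
  \<open>c\<close>.\<close>

locale curve_map = feathered_history D' P es for D' P es +
  fixes D :: fibre_div and \<Phi> :: "curve \<Rightarrow> curve"
  assumes len: "len D' = len D"
    and bij: "bij_betw \<Phi> (curves D) (curves D')"
    and map_Ch: "a \<le> len D \<Longrightarrow> \<Phi> (Ch a) = Ch a"
    and map_Br: "Br x y \<in> curves D \<Longrightarrow> \<exists>u v. \<Phi> (Br x y) = Br u v"
    and map_Re: "Re x y k \<in> curves D \<Longrightarrow> \<exists>u v. \<Phi> (Re x y k) = Re u v k"
    and centre: "Br x y \<in> curves D \<Longrightarrow> a \<le> len D \<Longrightarrow> Ch a \<in> P (\<Phi> (Br x y)) \<longleftrightarrow> a = x"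
    and fixed_matrix: "A \<in> curves D \<Longrightarrow> C \<in> curves D \<Longrightarrow>
      \<not> (A \<in> bridges D \<and> (\<exists>s\<in>curves D'. \<Phi> A \<in> P s)) \<Longrightarrow>
      \<not> (C \<in> bridges D \<and> (\<exists>s\<in>curves D'. \<Phi> C \<in> P s)) \<Longrightarrow>
      int_matrix D' (\<Phi> A) (\<Phi> C) = int_matrix D A C"
begin

text \<open>In the application these are the bridges whose image is a reducible total
  transform.\<close>

definition jumping :: "curve \<Rightarrow> bool" where
  "jumping A \<longleftrightarrow> A \<in> bridges D \<and> (\<exists>s\<in>curves D'. \<Phi> A \<in> P s)"

lemmas matrix = fixed_matrix[folded jumping_def]

lemma map_mem: "A \<in> curves D \<Longrightarrow> \<Phi> A \<in> curves D'"
  using bij by (auto simp: bij_betw_def)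

lemma map_inj: "A \<in> curves D \<Longrightarrow> C \<in> curves D \<Longrightarrow> \<Phi> A = \<Phi> C \<Longrightarrow> A = C"
  using bij by (auto simp: bij_betw_def dest: inj_onD)

lemma map_surj:
  assumes "C \<in> curves D'"
  obtains A where "A \<in> curves D" "\<Phi> A = C"
proof -
  have "C \<in> \<Phi> ` curves D" using bij assms by (simp add: bij_betw_def)
  then show ?thesis using that by blast
qed

lemma not_jumping [simp]: "\<not> jumping (Ch a)" "\<not> jumping (Re x y k)"
  by (auto simp: jumping_def bridges_def)

lemma map_meets:
  assumes "A \<in> curves D" and "C \<in> curves D" and "\<not> jumping A" and "\<not> jumping C" and "A \<noteq> C"
  shows "meets (\<Phi> A) (\<Phi> C) \<longleftrightarrow> meets A C"
proof -
  have "\<Phi> A \<noteq> \<Phi> C" using map_inj assms by blast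
  then show ?thesis using matrix[OF assms(1-4)] assms(5)
    by (simp add: int_matrix_def of_bool_eq_iff)
qed

lemma bridge_source:
  assumes "Br u v \<in> curves D'"
  obtains x y where "Br x y \<in> curves D" "\<Phi> (Br x y) = Br u v"
proof -
  obtain A where A: "A \<in> curves D" "\<Phi> A = Br u v" using map_surj[OF assms] .
  show ?thesis
  proof (cases A)
    case (Ch a)
    then show ?thesis using A map_Ch[of a] by auto
  next
    case (Br x y)
    then show ?thesis using A that by blast
  next
    case (Re x y k)
    then show ?thesis using A map_Re[of x y k] by auto
  qed
qed

lemma tail_source:
  assumes "Re u v k \<in> curves D'"
  obtains x y where "Re x y k \<in> curves D" "\<Phi> (Re x y k) = Re u v k"
proof -
  obtain A where A: "A \<in> curves D" "\<Phi> A = Re u v k" using map_surj[OF assms] .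
  show ?thesis
  proof (cases A)
    case (Ch a)
    then show ?thesis using A map_Ch[of a] by auto
  next
    case (Br x y)
    then show ?thesis using A map_Br[of x y] by auto
  next
    case (Re x y l)
    then have "l = k" using A map_Re[of x y l] by auto
    then show ?thesis using A Re that by blast
  qed
qed

lemma map_fixed_bridge:
  assumes "Br x y \<in> curves D" and "\<not> jumping (Br x y)" and "\<Phi> (Br x y) = Br u v"
  shows "u = x"
  using map_meets[of "Ch x" "Br x y"] assms map_Ch[of x] by auto

text \<open>\<open>map_Re\<close> keeps the position and \<open>map_meets\<close> the adjacency, so
  the tail follows its bridge link by link.\<close>

lemma map_fixed_tail:
  assumes b: "Br x y \<in> curves D" "\<not> jumping (Br x y)" "\<Phi> (Br x y) = Br u v"
    and "Re x y k \<in> curves D"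
  shows "\<Phi> (Re x y k) = Re u v k"
  using assms(4)
proof (induction k)
  case 0
  then show ?case by simp
next
  case (Suc k)
  obtain u' v' where uv: "\<Phi> (Re x y (Suc k)) = Re u' v' (Suc k)" using map_Re[OF Suc.prems] by blast
  show ?case
  proof (cases k)
    case 0
    then show ?thesis
      using map_meets[of "Br x y" "Re x y (Suc k)"] b Suc.prems uv by auto
  next
    case (Suc l)
    then have k: "Re x y k \<in> curves D" using Suc.prems by auto
    then show ?thesis
      using map_meets[of "Re x y k" "Re x y (Suc k)"] Suc.IH[OF k] Suc.prems uv by auto
  qed
qed

text \<open>The same induction along the target tail; it shows that no tail curve is gained.\<close>

lemma tail_of_fixed_bridge:
  assumes b: "Br x y \<in> curves D" "\<not> jumping (Br x y)" "\<Phi> (Br x y) = Br u v"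
    and "Re u v k \<in> curves D'"
  shows "Re x y k \<in> curves D"
  using assms(4)
proof (induction k)
  case 0
  then show ?case by simp
next
  case (Suc k)
  obtain x' y' where xy: "Re x' y' (Suc k) \<in> curves D" "\<Phi> (Re x' y' (Suc k)) = Re u v (Suc k)"
    using tail_source[OF Suc.prems] .
  show ?case
  proof (cases k)
    case 0
    then show ?thesis
      using map_meets[of "Br x y" "Re x' y' (Suc k)"] b xy by auto
  next
    case (Suc l)
    then have k: "Re x y k \<in> curves D" using Suc.IH Suc.prems by auto
    then show ?thesis
      using map_meets[of "Re x y k" "Re x' y' (Suc k)"] map_fixed_tail[OF b k] xy by auto
  qed
qed

lemma jump_facts:
  assumes "Br x y \<in> curves D" and "jumping (Br x y)" and "\<Phi> (Br x y) = Br u v"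
  shows jump_target_near: "Ch u \<in> near (Br u v)" and jump_target_less: "x < u"
    and jump_target_after: "x < a \<Longrightarrow> a \<le> len D \<Longrightarrow> Ch a \<in> near (Br u v)"
    and jump_target_gt_contractible:
      "contractible (region D' (Suc u) u - feather u v) (int_matrix D')"
    and jump_target_ge_contractible: "u = len D \<Longrightarrow>
      contractible (region D' (Suc x) (Suc x) - feather u v) (int_matrix D')"
proof -
  obtain s where s: "s \<in> curves D'" "Br u v \<in> P s" using assms by (auto simp: jumping_def)
  have c: "Br u v \<in> curves D'" using map_mem assms by metis
  have ce: "Ch a \<in> P (Br u v) \<longleftrightarrow> a = x" if "a \<le> len D'" for a
    using centre[of x y a] assms that len by simp
  have x: "x \<le> len D'" using assms(1) len by simp
  note j = c s ce x
  show "Ch u \<in> near (Br u v)" by (rule jump_chain_mem[OF j])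
  show "x < u" by (rule jump_less[OF j])
  show "x < a \<Longrightarrow> a \<le> len D \<Longrightarrow> Ch a \<in> near (Br u v)"
    using jump_chain_after[OF j, of a] len by simp
  show "contractible (region D' (Suc u) u - feather u v) (int_matrix D')"
    by (rule jump_region_contractible[OF j])
  show "u = len D \<Longrightarrow> contractible (region D' (Suc x) (Suc x) - feather u v) (int_matrix D')"
    using jump_last_contractible[OF j] len by simp
qed

text \<open>Jumps go strictly up, so a jumping bridge in the region would land there, hence at
  \<open>Br p q\<close>, hence be \<open>Br i j\<close> with \<open>i < l\<close>. Thus
  \<open>\<Phi>\<close> maps the region of \<open>D\<close> isometrically onto that of
  \<open>D'\<close> without the feather \<open>(p, q)\<close>, and contractibility is pulled
  back.\<close>

lemma region_image:
  assumes b: "Br i j \<in> curves D" "jumping (Br i j)" "\<Phi> (Br i j) = Br p q" and il: "i < l"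
    and others: "\<And>x y u v. Br x y \<in> curves D \<Longrightarrow> jumping (Br x y) \<Longrightarrow> \<Phi> (Br x y) = Br u v \<Longrightarrow>
      l \<le> u \<Longrightarrow> Br u v = Br p q"
    and cont: "contractible (region D' k l - feather p q) (int_matrix D')"
  shows "contractible (region D k l) (int_matrix D)"
proof -
  have src: "\<not> jumping (Br x y)" if xy: "Br x y \<in> curves D" "l \<le> x" for x y
  proof
    assume jp: "jumping (Br x y)"
    obtain u v where uv: "\<Phi> (Br x y) = Br u v" using map_Br xy by blast
    have "x < u" using jump_target_less[OF xy(1) jp uv] .
    then have "Br u v = Br p q" using others[OF xy(1) jp uv] xy(2) by simp
    then have "Br x y = Br i j" using map_inj[OF xy(1) b(1)] uv b(3) by simp
    then show False using xy il by simp
  qed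
  have tgt: "\<exists>y. Br u y \<in> curves D \<and> \<not> jumping (Br u y) \<and> \<Phi> (Br u y) = Br u v"
    if uv: "Br u v \<in> curves D'" "l \<le> u" "Br u v \<noteq> Br p q" for u v
  proof -
    obtain x y where xy: "Br x y \<in> curves D" "\<Phi> (Br x y) = Br u v" using bridge_source[OF uv(1)] .
    have "\<not> jumping (Br x y)" using others[OF xy(1) _ xy(2)] uv by blast
    moreover have "u = x" using map_fixed_bridge[OF xy(1) calculation xy(2)] .
    ultimately show ?thesis using xy by blast
  qed
  have fwd: "\<exists>v. \<Phi> (Br x y) = Br x v \<and> Br x v \<noteq> Br p q" if xy: "Br x y \<in> curves D" "l \<le> x" for x y
  proof -
    obtain u v where uv: "\<Phi> (Br x y) = Br u v" using map_Br xy by blast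
    have "u = x" using map_fixed_bridge[OF xy(1) src[OF xy] uv] .
    moreover have "Br u v \<noteq> Br p q" using map_inj[OF xy(1) b(1)] uv b(3) xy il by auto
    ultimately show ?thesis using uv by blast
  qed
  have sub1: "\<Phi> A \<in> region D' k l - feather p q" if A: "A \<in> region D k l" for A
  proof (cases A)
    case (Ch a)
    then show ?thesis using A map_Ch[of a] len by simp
  next
    case (Br x y)
    then have xy: "Br x y \<in> curves D" "l \<le> x" using A by simp_all
    then obtain v where "\<Phi> (Br x y) = Br x v" "Br x v \<noteq> Br p q" using fwd by blast
    then show ?thesis using map_mem[OF xy(1)] xy Br by auto
  next
    case (Re x y w)
    then have m: "Re x y w \<in> curves D" and xy: "Br x y \<in> curves D" "l \<le> x" using A by auto
    then obtain v where v: "\<Phi> (Br x y) = Br x v" "Br x v \<noteq> Br p q" using fwd by blast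
    have "\<Phi> (Re x y w) = Re x v w" using map_fixed_tail[OF xy(1) src[OF xy] v(1) m] .
    then show ?thesis using map_mem[OF m] xy v Re by auto
  qed
  have sub2: "C \<in> \<Phi> ` region D k l" if C: "C \<in> region D' k l - feather p q" for C
  proof (cases C)
    case (Ch a)
    then have "Ch a \<in> region D k l" using C len by simp
    moreover have "C = \<Phi> (Ch a)" using Ch C map_Ch[of a] len by simp
    ultimately show ?thesis by blast
  next
    case (Br u v)
    then have "Br u v \<in> curves D'" "l \<le> u" "Br u v \<noteq> Br p q" using C by auto
    then obtain y where "Br u y \<in> curves D" "\<Phi> (Br u y) = Br u v" using tgt by blast
    then show ?thesis using Br \<open>l \<le> u\<close> by (intro image_eqI[of _ _ "Br u y"]) auto
  next
    case (Re u v w)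
    then have m: "Re u v w \<in> curves D'" and uv: "Br u v \<in> curves D'" "l \<le> u" "Br u v \<noteq> Br p q"
      using C by auto
    then obtain y where y: "Br u y \<in> curves D" "\<not> jumping (Br u y)" "\<Phi> (Br u y) = Br u v"
      using tgt by blast
    have r: "Re u y w \<in> curves D" by (rule tail_of_fixed_bridge[OF y m])
    then have "\<Phi> (Re u y w) = Re u v w" by (rule map_fixed_tail[OF y])
    then show ?thesis using Re r uv by (intro image_eqI[of _ _ "Re u y w"]) auto
  qed
  have img: "region D' k l - feather p q = \<Phi> ` region D k l" using sub1 sub2 by blast
  have inj: "inj_on \<Phi> (region D k l)"
    using bij region_subset[of D k l] by (auto simp: bij_betw_def intro: inj_on_subset)
  let ?g = "inv_into (region D k l) \<Phi>"
  have nj: "\<not> jumping A" if "A \<in> region D k l" for A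
    using that src by (cases A) auto
  have "contractible (?g ` (\<Phi> ` region D k l)) (int_matrix D)"
  proof (rule contractible_image)
    show "contractible (\<Phi> ` region D k l) (int_matrix D')" using cont img by simp
    show "inj_on ?g (\<Phi> ` region D k l)" by (simp add: inj_on_inv_into)
    fix A C assume "A \<in> \<Phi> ` region D k l" "C \<in> \<Phi> ` region D k l"
    then obtain A0 C0 where AC: "A = \<Phi> A0" "A0 \<in> region D k l" "C = \<Phi> C0" "C0 \<in> region D k l" by auto
    then have "?g A = A0" "?g C = C0" using inj by (simp_all add: inv_into_f_f)
    moreover have "A0 \<in> curves D" "C0 \<in> curves D" using AC region_subset by blast+
    ultimately show "int_matrix D (?g A) (?g C) = int_matrix D' A C"
      using matrix nj AC by simp
  qed
  then show ?thesis using inj by (simp add: image_comp inv_into_f_f cong: image_cong_simp)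
qed

lemma no_jump:
  assumes dist: "distinguished D"
    and cond: "div_gt D (len D) \<noteq> {} \<or>
         (\<forall>i<len D. {1..feathers D i} \<noteq> {} \<longrightarrow>
            \<not> contractible (div_ge D (i + 1)) (int_matrix D))"
  shows "\<not> jumping A"
proof
  assume "jumping A"
  define J where "J = {u. \<exists>x y v. Br x y \<in> curves D \<and> jumping (Br x y) \<and> \<Phi> (Br x y) = Br u v}"
  obtain x y where A: "A = Br x y" "Br x y \<in> curves D"
    using \<open>jumping A\<close> curves_mem_bridges by (auto simp: jumping_def bridges_def)
  then have "J \<noteq> {}" using map_Br[of x y] \<open>jumping A\<close> by (auto simp: J_def)
  moreover have J_le: "u \<le> len D" if "u \<in> J" for u
  proof -
    obtain x y v where "Br x y \<in> curves D" "\<Phi> (Br x y) = Br u v" using \<open>u \<in> J\<close> J_def by blast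
    then show ?thesis using map_mem[of "Br x y"] len by auto
  qed
  then have fin: "finite J" using finite_subset[of J "{..len D}"] by auto
  ultimately have "Max J \<in> J" by simp
  then obtain i j p q where p: "p = Max J" and b: "Br i j \<in> curves D" "jumping (Br i j)"
    "\<Phi> (Br i j) = Br p q" unfolding J_def by blast
  have pl: "p \<le> len D" using J_le \<open>Max J \<in> J\<close> p by simp
  have ip: "i < p" using jump_target_less[OF b] .
  have "contractible (region D (Suc p) p) (int_matrix D)"
  proof (rule region_image[OF b ip])
    fix x y u v assume xy: "Br x y \<in> curves D" "jumping (Br x y)" "\<Phi> (Br x y) = Br u v" "p \<le> u"
    then have "u \<in> J" unfolding J_def by blast
    \<comment> \<open>Maximality of \<open>p\<close>. Two different bridges landing at
      \<open>Ch p\<close> would both have it infinitely near.\<close>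
    then have "u = p" using Max_ge[OF fin, of u] xy(4) p by simp
    then show "Br u v = Br p q"
      using jump_unique[of p p v q] jump_target_near[OF xy(1-3)] jump_target_near[OF b] ip pl len
      by auto
  next
    show "contractible (region D' (Suc p) p - feather p q) (int_matrix D')"
      by (rule jump_target_gt_contractible[OF b])
  qed
  moreover have gt: "div_gt D p = region D (Suc p) p" using div_gt_region ip pl by simp
  ultimately have empty: "region D (Suc p) p = {}"
    using dist ip pl unfolding distinguished_def by (metis One_nat_def Suc_leI not_less_zero gr0I)
  have "p = len D"
  proof (rule ccontr)
    assume "p \<noteq> len D"
    then have "Ch (Suc p) \<in> region D (Suc p) p" using pl by simp
    then show False using empty by simp
  qed
  then have "div_gt D (len D) = {}" using gt empty by simp
  \<comment> \<open>The jumping bridge itself makes the feather collection at \<open>Ch i\<close>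
    non-empty.\<close>
  moreover have "{1..feathers D i} \<noteq> {}" "i < len D" using b(1) ip \<open>p = len D\<close> by auto
  ultimately have "\<not> contractible (div_ge D (i + 1)) (int_matrix D)" using cond by blast
  moreover have "contractible (region D (Suc i) (Suc i)) (int_matrix D)"
  proof (rule region_image[OF b])
    show "i < Suc i" by simp
    show "contractible (region D' (Suc i) (Suc i) - feather p q) (int_matrix D')"
      by (rule jump_target_ge_contractible[OF b \<open>p = len D\<close>])
    fix x y u v assume xy: "Br x y \<in> curves D" "jumping (Br x y)" "\<Phi> (Br x y) = Br u v" "Suc i \<le> u"
    then have "u \<in> J" unfolding J_def by blast
    \<comment> \<open>\<open>Ch u\<close> is infinitely near to \<open>Br u v\<close>, and also to
      \<open>Br p q\<close>, whose jump covers all chain curves after \<open>Ch i\<close>.\<close>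
    then have "u \<le> p" using Max_ge[OF fin] p by simp
    then show "Br u v = Br p q"
      using jump_unique[of u p q v] jump_target_near[OF xy(1-3)] jump_target_after[OF b, of u] xy(4) pl len
      by auto
  qed
  ultimately show False using div_ge_region[OF \<open>i < len D\<close>] by simp
qed

end


text \<open>Once jumps are excluded, every bridge goes to a single curve, and its intersection with
  the chain keeps its index \<open>i\<close>. Bijectivity of the numbering is inherited from
  \<open>\<Phi>\<close>.\<close>

lemma lattice_iso_maps_bridges:
  assumes D: "feathered_fibre D" and D': "feathered_fibre D'" and dist: "distinguished D"
    and self: "\<forall>A\<in>bridges D. selfint D A = -1"
    and cond: "div_gt D (len D) \<noteq> {} \<or>
         (\<forall>i<len D. {1..feathers D i} \<noteq> {} \<longrightarrow>
            \<not> contractible (div_ge D (i + 1)) (int_matrix D))"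
    and \<delta>: "lattice_iso D D' \<delta>"
  shows "maps_bridges D D' \<delta>"
proof -
  obtain P es where hist: "fibre_history D' P es" using feathered_fibre_history[OF D'] .
  then interpret h': fibre_history D' P es .
  note bij = lattice_isoD(4)[OF \<delta>] and len = lattice_isoD(2)[OF \<delta>]
    and num = lattice_isoD(5)[OF \<delta>, rule_format] and ch = lattice_isoD(8)[OF \<delta>, rule_format]
    and re = lattice_isoD(9)[OF \<delta>, rule_format]
  have bij_inj: "A = C" if "A \<in> curves D" "C \<in> curves D" "\<delta> (frag_of A) = \<delta> (frag_of C)" for A C
  proof -
    have "inj_on \<delta> (carrier (cycles D))" using bij by (rule bij_betw_imp_inj_on)
    then have "frag_of A = frag_of C"
      using that(3) frag_of_mem_cycles[OF that(1)] frag_of_mem_cycles[OF that(2)] by (rule inj_onD)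
    then show ?thesis by (simp add: frag_of_eq)
  qed
  define good where "good A C \<longleftrightarrow> (case A of
      Ch a \<Rightarrow> C = Ch a
    | Br x y \<Rightarrow> C \<in> bridges D' \<and> \<delta> (frag_of A) = h'.transform C \<and> (\<forall>a\<le>len D. Ch a \<in> P C \<longleftrightarrow> a = x)
    | Re x y k \<Rightarrow> \<delta> (frag_of A) = frag_of C \<and> C \<in> curves D' \<and> (\<exists>u v. C = Re u v k))" for A C
  have ex: "\<exists>C. good A C" if A: "A \<in> curves D" for A
  proof (cases A)
    case (Ch a)
    then show ?thesis by (simp add: good_def)
  next
    case (Br x y)
    then have "Br x y \<in> bridges D" using A by simp
    then obtain c where "c \<in> bridges D'" "\<delta> (frag_of (Br x y)) = h'.transform c"
      "\<forall>a\<le>len D. Ch a \<in> P c \<longleftrightarrow> a = x"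
      using bridge_image[OF hist \<delta>, of x y] self by blast
    then have "good A c" using Br by (simp add: good_def)
    then show ?thesis by blast
  next
    case (Re x y k)
    then have "Re x y k \<in> tails D" using A by simp
    from re[OF this] obtain u v where uv: "Re u v k \<in> tails D'"
      "\<delta> (frag_of (Re x y k)) = frag_of (Re u v k)" by (elim exE conjE)
    have "good A (Re u v k)" using Re uv(2) curves_mem_tails[OF uv(1)] by (simp add: good_def)
    then show ?thesis by blast
  qed
  define \<Phi> where "\<Phi> A = (SOME C. good A C)" for A
  have good: "good A (\<Phi> A)" if "A \<in> curves D" for A
    unfolding \<Phi>_def using ex[OF that] by (rule someI_ex)
  have map_Ch: "\<Phi> (Ch a) = Ch a" if "a \<le> len D" for a
    using good[of "Ch a"] that by (simp add: good_def)
  have map_Br: "\<Phi> (Br x y) \<in> bridges D'" "\<delta> (frag_of (Br x y)) = h'.transform (\<Phi> (Br x y))"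
    "\<forall>a\<le>len D. Ch a \<in> P (\<Phi> (Br x y)) \<longleftrightarrow> a = x" if "Br x y \<in> curves D" for x y
    using good[OF that] by (simp_all add: good_def)
  have map_Re: "\<delta> (frag_of (Re x y k)) = frag_of (\<Phi> (Re x y k))" "\<Phi> (Re x y k) \<in> curves D'"
    "\<exists>u v. \<Phi> (Re x y k) = Re u v k" if "Re x y k \<in> curves D" for x y k
    using good[OF that] by (simp_all add: good_def)
  have mem: "\<Phi> A \<in> curves D'" if A: "A \<in> curves D" for A
  proof (cases A)
    case (Ch a)
    then show ?thesis using map_Ch[of a] A len by simp
  next
    case (Br x y)
    then show ?thesis using curves_mem_bridges[OF map_Br(1)[of x y]] A by simp
  next
    case (Re x y k)
    then show ?thesis using map_Re(2)[of x y k] A by simp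
  qed
  have frag: "\<delta> (frag_of A) = frag_of (\<Phi> A)" 
    if A: "A \<in> curves D" "\<not> (A \<in> bridges D \<and> (\<exists>s\<in>curves D'. \<Phi> A \<in> P s))" for A
  proof (cases A)
    case (Ch a)
    then show ?thesis using map_Ch[of a] A ch[of a] by simp
  next
    case (Br x y)
    then have "h'.transform (\<Phi> A) = frag_of (\<Phi> A)"
      using A mem[of A] by (intro h'.transform_childless) auto
    then show ?thesis using Br map_Br(2)[of x y] A by simp
  next
    case (Re x y k)
    then show ?thesis using map_Re(1)[of x y k] A by simp
  qed
  have shape: "case A of Ch a \<Rightarrow> \<Phi> A = Ch a | Br x y \<Rightarrow> \<exists>u v. \<Phi> A = Br u v
      | Re x y k \<Rightarrow> \<exists>u v. \<Phi> A = Re u v k" if A: "A \<in> curves D" for A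
  proof (cases A)
    case (Ch a)
    then show ?thesis using map_Ch[of a] A by simp
  next
    case (Br x y)
    then show ?thesis using map_Br(1)[of x y] A by (auto simp: bridges_def)
  next
    case (Re x y k)
    then show ?thesis using map_Re(3)[of x y k] A by simp
  qed
  have "inj_on \<Phi> (curves D)"
  proof (rule inj_onI)
    fix A C assume A: "A \<in> curves D" and C: "C \<in> curves D" and eq: "\<Phi> A = \<Phi> C"
    show "A = C"
    proof (cases A)
      case (Ch a)
      then show ?thesis using shape[OF A] shape[OF C] eq by (cases C) auto
    next
      case (Br x y)
      then obtain x' y' where "C = Br x' y'" using shape[OF A] shape[OF C] eq by (cases C) auto
      then show ?thesis using bij_inj[OF A C] map_Br(2)[of x y] map_Br(2)[of x' y'] Br A C eq by simp
    next
      case (Re x y k)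
      then obtain x' y' k' where "C = Re x' y' k'" using shape[OF A] shape[OF C] eq by (cases C) auto
      then show ?thesis
        using bij_inj[OF A C] map_Re(1)[of x y k] map_Re(1)[of x' y' k'] Re A C eq by simp
    qed
  qed
  moreover have "\<Phi> ` curves D = curves D'"
  \<comment> \<open>Both fibres have one component more than there are blowups, so injectivity
    implies surjectivity.\<close>
  proof (rule card_subset_eq[OF finite_curves])
    show "\<Phi> ` curves D \<subseteq> curves D'" using mem by blast
    show "card (\<Phi> ` curves D) = card (curves D')"
      using card_image[OF calculation] card_curves[OF D] card_curves[OF D'] lattice_isoD(1)[OF \<delta>] by simp
  qed
  ultimately have bij\<Phi>: "bij_betw \<Phi> (curves D) (curves D')" by (simp add: bij_betw_def)
  interpret m: curve_map D' P es D \<Phi>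
  proof (unfold_locales)
    show "selfint D' A \<le> -2" if "A \<in> tails D'" for A
      using D' that by (simp add: feathered_fibre_def)
    show "len D' = len D" by (rule len)
    show "bij_betw \<Phi> (curves D) (curves D')" by (rule bij\<Phi>)
    show "\<Phi> (Ch a) = Ch a" if "a \<le> len D" for a using map_Ch[OF that] .
    show "\<exists>u v. \<Phi> (Br x y) = Br u v" if "Br x y \<in> curves D" for x y
      using map_Br(1)[OF that] by (auto simp: bridges_def)
    show "\<exists>u v. \<Phi> (Re x y k) = Re u v k" if "Re x y k \<in> curves D" for x y k
      using map_Re(3)[OF that] .
    show "Ch a \<in> P (\<Phi> (Br x y)) \<longleftrightarrow> a = x" if "Br x y \<in> curves D" "a \<le> len D" for x y a
      using map_Br(3)[OF that(1)] that(2) by blast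
    show "int_matrix D' (\<Phi> A) (\<Phi> C) = int_matrix D A C"
      if "A \<in> curves D" "C \<in> curves D"
        "\<not> (A \<in> bridges D \<and> (\<exists>s\<in>curves D'. \<Phi> A \<in> P s))"
        "\<not> (C \<in> bridges D \<and> (\<exists>s\<in>curves D'. \<Phi> C \<in> P s))" for A C
      using num[OF frag_of_mem_cycles[OF that(1)] frag_of_mem_cycles[OF that(2)]]
        frag[OF that(1,3)] frag[OF that(2,4)] by (simp add: int_number_frag_of)
  qed
  have nj: "\<not> m.jumping A" for A by (rule m.no_jump[OF dist cond])
  define \<pi> where "\<pi> i j = (case \<Phi> (Br i j) of Br u v \<Rightarrow> v | _ \<Rightarrow> 0)" for i j
  have pi: "\<Phi> (Br i j) = Br i (\<pi> i j)" if ij: "Br i j \<in> curves D" for i j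
  proof -
    obtain u v where uv: "\<Phi> (Br i j) = Br u v" using m.map_Br[OF ij] by blast
    then show ?thesis using m.map_fixed_bridge[OF ij nj uv] by (simp add: \<pi>_def)
  qed
  show ?thesis unfolding maps_bridges_def
  proof (intro allI impI exI conjI ballI)
    fix i assume i: "i \<le> len D"
    have mem_iff: "j \<in> {1..feathers D i} \<longleftrightarrow> Br i j \<in> curves D"
      "j \<in> {1..feathers D' i} \<longleftrightarrow> Br i j \<in> curves D'" for j
      using i len by auto
    show "bij_betw (\<pi> i) {1..feathers D i} {1..feathers D' i}"
    proof (rule bij_betwI')
      fix j k assume j: "j \<in> {1..feathers D i}" and k: "k \<in> {1..feathers D i}"
      show "\<pi> i j = \<pi> i k \<longleftrightarrow> j = k"
        using pi[of i j] pi[of i k] m.map_inj[of "Br i j" "Br i k"] j k unfolding mem_iff by auto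
    next
      fix j assume "j \<in> {1..feathers D i}"
      then show "\<pi> i j \<in> {1..feathers D' i}"
        using pi[of i j] m.map_mem[of "Br i j"] unfolding mem_iff by simp
    next
      fix v assume "v \<in> {1..feathers D' i}"
      then have "Br i v \<in> curves D'" using i len by simp
      then obtain x y where xy: "Br x y \<in> curves D" "\<Phi> (Br x y) = Br i v"
        by (rule m.bridge_source)
      then have "x = i" "\<pi> i y = v" using pi[OF xy(1)] by auto
      moreover from this have "y \<in> {1..feathers D i}" using xy(1) unfolding mem_iff by simp
      ultimately show "\<exists>j\<in>{1..feathers D i}. v = \<pi> i j" by auto
    qed
    fix j assume "j \<in> {1..feathers D i}"
    then have ij: "Br i j \<in> curves D" using i by simp
    show "\<delta> (frag_of (Br i j)) = frag_of (Br i (\<pi> i j))"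
      using frag[OF ij nj[unfolded m.jumping_def]] pi[OF ij] by simp
  qed
qed

theorem theorem2p17:
  fixes D :: fibre_div
  assumes "feathered_fibre D"
    and "distinguished D"
    and "\<forall>A\<in>bridges D. selfint D A = -1"
    and "div_gt D (len D) \<noteq> {} \<or>
         (\<forall>i<len D. {1..feathers D i} \<noteq> {} \<longrightarrow>
            \<not> contractible (div_ge D (i + 1)) (int_matrix D))"
  shows "rigid D"
  unfolding rigid_def stable_under_specialization_def stable_under_generalization_def
proof (intro conjI allI impI)
  fix D' \<delta>
  assume D': "feathered_fibre D'" and \<delta>: "formal_specialization D D' \<delta>"
  show "maps_bridges D D' \<delta>"
    by (rule lattice_iso_maps_bridges[OF assms(1) D' assms(2-4)
          specialization_lattice_iso[OF assms(1) D' \<delta>]])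
next
  fix D' \<gamma>
  assume D': "feathered_fibre D'" and \<gamma>: "formal_generalization D D' \<gamma>"
  show "maps_bridges D D' \<gamma>"
    by (rule lattice_iso_maps_bridges[OF assms(1) D' assms(2-4)
          generalization_lattice_iso[OF assms(1) D' \<gamma>]])
qed

end
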